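(* Let $\alpha$ be some fixed level in $(0,1)$, let $B\ge1$ be an integer, let $K:\mathbb{X}\times\mathbb{X}\to\mathbb{R}$ be a symmetric kernel function with $\int_{\mathbb{X}^2}K^2(x,x')(f+g)(x)(f+g)(x')\,d\nu_xd\nu_{x'}<+\infty$, and let $\hat\Phi_{K,\alpha}=\mathbf{1}_{\hat T_K>\hat q^{(N)}_{K,1-\alpha}}$ be the test based on the Monte Carlo approximation $\hat q^{(N)}_{K,1-\alpha}$ of the conditional quantile. Under the null hypothesis $f=g$, $$\mathbb{P}\left(\hat\Phi_{K,\alpha}=1\,\big|\,N\right)\le\frac{\lfloor B\alpha\rfloor+1}{B+1}.$$
   Context: Let $\mathbb{X}$ be a measurable space, $\nu$ a non-atomic positive $\sigma$-finite measure on $\mathbb{X}$, $n>0$ a number, and $d\mu=n\,d\nu$. $N^1$ and $N^{-1}$ are independent Poisson processes on $\mathbb{X}$ with (nonnegative) intensities $f$ and $g$ with respect to $\mu$. Standing assumptions: $f,g$ are $\nu$-integrable and bounded (finite supremum). $N$ is the pooled process (point measure $dN=dN^1+dN^{-1}$); for $x\in N$, $\varepsilon^0_x=1$ if $x\in N^1$ and $\varepsilon^0_x=-1$ if $x\in N^{-1}$. The test statistic is $\hat T_K=\sum_{x\ne x'\in N}K(x,x')\varepsilon^0_x\varepsilon^0_{x'}$. Monte Carlo quantile: conditionally on $N$, consider $B$ independent sequences $\varepsilon^b=(\varepsilon^b_x)_{x\in N}$, $1\le b\le B$, each a sequence of i.i.d. Rademacher variables (uniform on $\{-1,1\}$), independent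 of the marks $(\varepsilon^0_x)_{x\in N}$ given $N$. Set $\hat T_K^{\varepsilon^b}=\sum_{x\ne x'\in N}K(x,x')\varepsilon^b_x\varepsilon^b_{x'}$, $F_{K,B}(t)=\frac1B\sum_{b=1}^B\mathbf{1}_{\hat T_K^{\varepsilon^b}\le t}$ for $t\in\mathbb{R}$, and $\hat q^{(N)}_{K,1-\alpha}=\inf\{t\in\mathbb{R}:F_{K,B}(t)\ge1-\alpha\}$. *)

theory Defs
  imports "HOL-Probability.Probability"
begin

definition non_atomic :: "'a measure \<Rightarrow> bool" where
  "non_atomic \<nu> \<longleftrightarrow>
     (\<forall>A\<in>sets \<nu>. emeasure \<nu> A > 0 \<longrightarrow>
        (\<exists>C\<in>sets \<nu>. C \<subseteq> A \<and> 0 < emeasure \<nu> C \<and> emeasure \<nu> C < emeasure \<nu> A))"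

text \<open>
  A point process is a random countable set of points. Its point measure
  is \<open>A \<mapsto> num_points S A\<close>, which may take the value \<open>\<infinity>\<close>.
\<close>

definition num_points :: "'a set \<Rightarrow> 'a set \<Rightarrow> ennreal" where
  "num_points S A = emeasure (count_space UNIV) (S \<inter> A)"

text \<open>
  The configurations of points in \<open>X\<close>, with the \<open>\<sigma>\<close>-algebra generated by the counts
  of points in measurable sets. Only \<open>space X\<close> and \<open>sets X\<close> matter.
\<close>

definition config_space :: "'a measure \<Rightarrow> 'a set measure" where
  "config_space X =
     sigma {S. S \<subseteq> space X \<and> countable S}
       {{S. S \<subseteq> space X \<and> countable S \<and> num_points S A \<in> U} | A U.
          A \<in> sets X \<and> U \<in> sets borel}"

definition poisson_process :: "'w measure \<Rightarrow> 'a measure \<Rightarrow> ('w \<Rightarrow> 'a set) \<Rightarrow> bool" where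
  "poisson_process M \<Lambda> N \<longleftrightarrow>
     N \<in> measurable M (config_space \<Lambda>) \<and>
     (\<forall>A\<in>sets \<Lambda>. emeasure \<Lambda> A < \<infinity> \<longrightarrow>
        (\<forall>k::nat. measure M {\<omega>\<in>space M. num_points (N \<omega>) A = of_nat k} =
           exp (- measure \<Lambda> A) * measure \<Lambda> A ^ k / fact k)) \<and>
     (\<forall>A\<in>sets \<Lambda>. emeasure \<Lambda> A = \<infinity> \<longrightarrow> (AE \<omega> in M. num_points (N \<omega>) A = \<infinity>)) \<and>
     (\<forall>(A :: nat \<Rightarrow> 'a set) m. (\<forall>i<m. A i \<in> sets \<Lambda>) \<longrightarrow> disjoint_family_on A {..<m} \<longrightarrow>
        prob_space.indep_vars M (\<lambda>_. borel) (\<lambda>i \<omega>. num_points (N \<omega>) (A i)) {..<m})"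

definition intensity_measure :: "real \<Rightarrow> 'a measure \<Rightarrow> ('a \<Rightarrow> real) \<Rightarrow> 'a measure" where
  "intensity_measure n \<nu> f = density (scale_measure (ennreal n) \<nu>) (\<lambda>x. ennreal (f x))"

text \<open>
  The pooled process. For independent processes with non-atomic intensities the two
  components are almost surely disjoint, so that its point measure is almost surely
  the sum of the two point measures.
\<close>

definition pooled :: "('w \<Rightarrow> 'a set) \<Rightarrow> ('w \<Rightarrow> 'a set) \<Rightarrow> 'w \<Rightarrow> 'a set" where
  "pooled N1 Nm1 \<omega> = N1 \<omega> \<union> Nm1 \<omega>"

text \<open>
  Used at points \<open>x\<close> of the pooled process only; the value at common points of the two
  components is a convention on a null event.
\<close>

definition sample_mark :: "('w \<Rightarrow> 'a set) \<Rightarrow> 'w \<Rightarrow> 'a \<Rightarrow> real" where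
  "sample_mark N1 \<omega> x = (if x \<in> N1 \<omega> then 1 else -1)"

text \<open>
  Events such as \<open>N1 \<omega> \<inter> Nm1 \<omega> \<noteq> {}\<close> are contained in measurable null events but need not
  be measurable themselves, since the diagonal of the underlying space need not be measurable.
  Conditional probabilities are therefore taken on the completed probability space.
\<close>

definition cond_prob_given :: "'w measure \<Rightarrow> 'w measure \<Rightarrow> 'w set \<Rightarrow> 'w \<Rightarrow> real" where
  "cond_prob_given M F E = real_cond_exp (completion M) F (indicator E)"

definition generated_by :: "'w measure \<Rightarrow> 'a measure \<Rightarrow> ('w \<Rightarrow> 'a set) \<Rightarrow> 'w measure" where
  "generated_by M X N = vimage_algebra (space M) N (config_space X)"

text \<open>
  A family of marks indexed by the points of a random set is treated as a random element
  through the configuration of marked points \<open>(x, m x)\<close>.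
\<close>

definition marked_points :: "('a \<Rightarrow> 'm) \<Rightarrow> 'a set \<Rightarrow> ('a \<times> 'm) set" where
  "marked_points m S = (\<lambda>x. (x, m x)) ` S"

text \<open>
  Conditionally on \<open>N\<close>, the marks \<open>(m \<omega> x)\<close>, with \<open>x \<in> N \<omega>\<close>, are i.i.d. with law \<open>p\<close>: the
  product law on \<open>N \<omega>\<close> is their conditional distribution.
  The product law is meaningful for finite \<open>N \<omega>\<close> only.
\<close>

definition cond_iid_marks ::
  "'w measure \<Rightarrow> 'a measure \<Rightarrow> ('w \<Rightarrow> 'a set) \<Rightarrow> 'm measure \<Rightarrow> 'm pmf \<Rightarrow> ('w \<Rightarrow> 'a \<Rightarrow> 'm) \<Rightarrow> bool"
where
  "cond_iid_marks M X N L p m \<longleftrightarrow>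
     (\<lambda>\<omega>. marked_points (m \<omega>) (N \<omega>)) \<in> measurable (completion M) (config_space (X \<Otimes>\<^sub>M L)) \<and>
     (\<forall>E\<in>sets (config_space (X \<Otimes>\<^sub>M L)).
        AE \<omega> in M.
          cond_prob_given M (generated_by M X N)
            {\<omega>\<in>space M. marked_points (m \<omega>) (N \<omega>) \<in> E} \<omega> =
          measure_pmf.prob (Pi_pmf (N \<omega>) undefined (\<lambda>_. p)) {y. marked_points y (N \<omega>) \<in> E})"

definition cond_indep_marks ::
  "'w measure \<Rightarrow> 'a measure \<Rightarrow> ('w \<Rightarrow> 'a set) \<Rightarrow> 'm measure \<Rightarrow> ('w \<Rightarrow> 'a \<Rightarrow> 'm) \<Rightarrow>
   'l measure \<Rightarrow> ('w \<Rightarrow> 'a \<Rightarrow> 'l) \<Rightarrow> bool"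
where
  "cond_indep_marks M X N L m L' m' \<longleftrightarrow>
     (\<forall>E\<in>sets (config_space (X \<Otimes>\<^sub>M L)). \<forall>E'\<in>sets (config_space (X \<Otimes>\<^sub>M L')).
        AE \<omega> in M.
          cond_prob_given M (generated_by M X N)
            {\<omega>\<in>space M. marked_points (m \<omega>) (N \<omega>) \<in> E \<and> marked_points (m' \<omega>) (N \<omega>) \<in> E'} \<omega> =
          cond_prob_given M (generated_by M X N)
            {\<omega>\<in>space M. marked_points (m \<omega>) (N \<omega>) \<in> E} \<omega> *
          cond_prob_given M (generated_by M X N)
            {\<omega>\<in>space M. marked_points (m' \<omega>) (N \<omega>) \<in> E'} \<omega>)"

definition rademacher :: "real pmf" where
  "rademacher = pmf_of_set {-1, 1}"

text \<open>
  The \<open>B\<close> sequences are bundled into one mark per point, the vector of its \<open>B\<close> signs.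
  That the sequences are independent and each is i.i.d. Rademacher means that these
  vectors are i.i.d. with law \<open>rademacher_vec B\<close>.
\<close>

definition rademacher_vec :: "nat \<Rightarrow> (nat \<Rightarrow> real) pmf" where
  "rademacher_vec B = Pi_pmf {1..B} undefined (\<lambda>_. rademacher)"

definition mark_vec_space :: "nat \<Rightarrow> (nat \<Rightarrow> real) measure" where
  "mark_vec_space B = Pi\<^sub>M {1..B} (\<lambda>_. borel)"

definition mark_vec :: "nat \<Rightarrow> (nat \<Rightarrow> 'w \<Rightarrow> 'a \<Rightarrow> real) \<Rightarrow> 'w \<Rightarrow> 'a \<Rightarrow> nat \<Rightarrow> real" where
  "mark_vec B \<epsilon> \<omega> x = (\<lambda>b\<in>{1..B}. \<epsilon> b \<omega> x)"

definition monte_carlo_marks ::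
  "'w measure \<Rightarrow> 'a measure \<Rightarrow> ('w \<Rightarrow> 'a set) \<Rightarrow> ('w \<Rightarrow> 'a \<Rightarrow> real) \<Rightarrow> nat \<Rightarrow>
   (nat \<Rightarrow> 'w \<Rightarrow> 'a \<Rightarrow> real) \<Rightarrow> bool"
where
  "monte_carlo_marks M X N \<epsilon>0 B \<epsilon> \<longleftrightarrow>
     cond_iid_marks M X N (mark_vec_space B) (rademacher_vec B) (mark_vec B \<epsilon>) \<and>
     cond_indep_marks M X N borel \<epsilon>0 (mark_vec_space B) (mark_vec B \<epsilon>)"

definition T_stat :: "('a \<Rightarrow> 'a \<Rightarrow> real) \<Rightarrow> 'a set \<Rightarrow> ('a \<Rightarrow> real) \<Rightarrow> real" where
  "T_stat K S e = (\<Sum>(x, x') \<in> {(x, x'). x \<in> S \<and> x' \<in> S \<and> x \<noteq> x'}. K x x' * e x * e x')"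

definition mc_cdf :: "('a \<Rightarrow> 'a \<Rightarrow> real) \<Rightarrow> nat \<Rightarrow> 'a set \<Rightarrow> (nat \<Rightarrow> 'a \<Rightarrow> real) \<Rightarrow> real \<Rightarrow> real" where
  "mc_cdf K B S e t = 1 / real B * (\<Sum>b = 1..B. of_bool (T_stat K S (e b) \<le> t))"

definition mc_quantile ::
  "('a \<Rightarrow> 'a \<Rightarrow> real) \<Rightarrow> nat \<Rightarrow> real \<Rightarrow> 'a set \<Rightarrow> (nat \<Rightarrow> 'a \<Rightarrow> real) \<Rightarrow> real"
where
  "mc_quantile K B \<alpha> S e = Inf {t. mc_cdf K B S e t \<ge> 1 - \<alpha>}"

definition mc_test ::
  "('a \<Rightarrow> 'a \<Rightarrow> real) \<Rightarrow> nat \<Rightarrow> real \<Rightarrow> ('w \<Rightarrow> 'a set) \<Rightarrow> ('w \<Rightarrow> 'a \<Rightarrow> real) \<Rightarrow>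
   (nat \<Rightarrow> 'w \<Rightarrow> 'a \<Rightarrow> real) \<Rightarrow> 'w \<Rightarrow> real"
where
  "mc_test K B \<alpha> N \<epsilon>0 \<epsilon> \<omega> =
     of_bool (T_stat K (N \<omega>) (\<epsilon>0 \<omega>) > mc_quantile K B \<alpha> (N \<omega>) (\<lambda>b. \<epsilon> b \<omega>))"

end

theory Submission
  imports Defs
begin

text \<open>
  The test rejects exactly if at least \<open>B - \<lfloor>B \<alpha>\<rfloor>\<close> of the \<open>B\<close> resampled statistics are smaller than
  the observed one (lemma \<open>mc_quantile_less_iff\<close>). Among any \<open>B + 1\<close> numbers, at most \<open>\<lfloor>B \<alpha>\<rfloor> + 1\<close> have
  so many smaller ones. If the observed and the resampled statistics are exchangeable given \<open>N\<close>, each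
  of them has the same conditional probability of being in this position, and summing the \<open>B + 1\<close>
  probabilities gives the bound (lemma \<open>exchangeable_rank_bound\<close>).

  Exchangeability holds because, given \<open>N\<close>, the \<open>B + 1\<close> statistics are independent with one common
  law. For the resampled ones this is an assumption. That the sample marks are also i.i.d.
  Rademacher given \<open>N\<close> is a thinning property of Poisson processes with equal intensities. It
  follows from Renyi's principle that a simple point process is determined by its avoidance
  probabilities: the configuration of points \<open>(x, \<plusminus>1)\<close> marked by the sample and the one marked by
  resampled signs both miss \<open>(A \<times> {1}) \<union> (A' \<times> {-1})\<close> with probability
  \<open>exp (- \<Lambda> A - \<Lambda> A')\<close>, where \<open>\<Lambda>\<close> is the common intensity measure (lemmas
  \<open>prob_sample_marks_avoid\<close>, \<open>prob_component_marks_avoid\<close> and \<open>law_determined_by_avoidance\<close>).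
  Hence they have the same law jointly with \<open>N\<close>.

  The underlying space is an arbitrary measurable space, whose \<open>\<sigma>\<close>-algebra need not separate points.
  Non-atomicity makes up for this: it yields finite partitions into sets of small measure, and
  almost surely some partition from a fixed sequence has at most one point of \<open>N\<close> in each cell
  (lemma \<open>ex_separating\<close>). This makes \<open>N\<close> finite and the two samples disjoint, and it lets
  avoidance events recover all counts.
\<close>

section \<open>Measurable functionals of configurations\<close>

lemma space_config_space: "space (config_space X) = {S. S \<subseteq> space X \<and> countable S}"
  unfolding config_space_def by (subst space_measure_of) auto

lemma sets_config_space:
  "sets (config_space X) = sigma_sets {S. S \<subseteq> space X \<and> countable S}
     {{S. S \<subseteq> space X \<and> countable S \<and> num_points S A \<in> U} | A U. A \<in> sets X \<and> U \<in> sets borel}"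
  unfolding config_space_def by (subst sets_measure_of) auto

lemma sets_config_space_cong:
  assumes "sets X = sets Y"
  shows "config_space X = config_space Y"
  unfolding config_space_def using assms sets_eq_imp_space_eq[OF assms] by simp

lemma measurable_num_points [measurable]:
  assumes "A \<in> sets X"
  shows "(\<lambda>S. num_points S A) \<in> borel_measurable (config_space X)"
proof (rule measurableI)
  fix U :: "ennreal set" assume "U \<in> sets borel"
  then have "{S. S \<subseteq> space X \<and> countable S \<and> num_points S A \<in> U} \<in> sets (config_space X)"
    unfolding sets_config_space using assms by (intro sigma_sets.Basic) auto
  moreover have "(\<lambda>S. num_points S A) -` U \<inter> space (config_space X)
      = {S. S \<subseteq> space X \<and> countable S \<and> num_points S A \<in> U}"
    by (auto simp: space_config_space)
  ultimately show "(\<lambda>S. num_points S A) -` U \<inter> space (config_space X) \<in> sets (config_space X)"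
    by simp
qed simp

text \<open>
  The \<open>\<sigma>\<close>-algebra is generated by the counts, so measurability needs to be tested on counts only.
\<close>

lemma measurable_config_spaceI:
  assumes "\<And>\<omega>. \<omega> \<in> space M \<Longrightarrow> F \<omega> \<in> space (config_space X)"
    and "\<And>A. A \<in> sets X \<Longrightarrow> (\<lambda>\<omega>. num_points (F \<omega>) A) \<in> borel_measurable M"
  shows "F \<in> measurable M (config_space X)"
  unfolding config_space_def
proof (rule measurable_measure_of)
  show "F \<in> space M \<rightarrow> {S. S \<subseteq> space X \<and> countable S}"
    using assms(1) by (auto simp: space_config_space)
next
  fix Z assume "Z \<in> {{S. S \<subseteq> space X \<and> countable S \<and> num_points S A \<in> U} | A U.
      A \<in> sets X \<and> U \<in> sets borel}"
  then obtain A U where AU: "A \<in> sets X" "U \<in> sets borel"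
    and Z: "Z = {S. S \<subseteq> space X \<and> countable S \<and> num_points S A \<in> U}"
    by auto
  have "F -` Z \<inter> space M = (\<lambda>\<omega>. num_points (F \<omega>) A) -` U \<inter> space M"
    using assms(1) Z by (auto simp: space_config_space)
  then show "F -` Z \<inter> space M \<in> sets M"
    using measurable_sets[OF assms(2)[OF AU(1)] AU(2)] by simp
qed auto

lemma num_points_finite: "finite (S \<inter> A) \<Longrightarrow> num_points S A = of_nat (card (S \<inter> A))"
  unfolding num_points_def by (simp add: emeasure_count_space_finite)

lemma num_points_infinite: "infinite (S \<inter> A) \<Longrightarrow> num_points S A = \<infinity>"
  unfolding num_points_def by (simp add: emeasure_count_space_infinite)

lemma num_points_cases: "num_points S A = (if finite (S \<inter> A) then of_nat (card (S \<inter> A)) else \<infinity>)"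
  by (simp add: num_points_finite num_points_infinite)

lemma num_points_space:
  "S \<subseteq> space X \<Longrightarrow> num_points S (space X) = (if finite S then of_nat (card S) else \<infinity>)"
  by (simp add: num_points_cases Int_absorb2)

lemma num_points_eq_0_iff: "num_points S A = 0 \<longleftrightarrow> S \<inter> A = {}"
  by (auto simp: num_points_cases)

lemma num_points_le_1_iff: "num_points S A \<le> 1 \<longleftrightarrow> finite (S \<inter> A) \<and> card (S \<inter> A) \<le> 1"
  by (auto simp: num_points_cases top_unique)

lemma num_points_Un_disjoint:
  "S \<inter> S' \<inter> A = {} \<Longrightarrow> num_points (S \<union> S') A = num_points S A + num_points S' A"
  unfolding num_points_def Int_Un_distrib2
  by (intro plus_emeasure[symmetric]) auto

text \<open>
  The law of a uniformly chosen point of a finite configuration. It is the zero measure for the empty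
  and for infinite configurations, so that it is a sub-probability kernel on the space of all
  configurations, and a sum over the points of a configuration is their number times an integral against it.
\<close>

definition sampling_measure :: "'a measure \<Rightarrow> 'a set \<Rightarrow> 'a measure" where
  "sampling_measure X S = distr (uniform_count_measure S) X (\<lambda>x. x)"

lemma measurable_uniform_count_id:
  "S \<subseteq> space X \<Longrightarrow> (\<lambda>x. x) \<in> measurable (uniform_count_measure S) X"
  by (auto simp: measurable_def space_uniform_count_measure sets_uniform_count_measure)

lemma sampling_measure_integral:
  fixes h :: "'a \<Rightarrow> real"
  assumes "finite S" "S \<subseteq> space X" "h \<in> borel_measurable X"
  shows "integral\<^sup>L (sampling_measure X S) h = sum h S / real (card S)"
  unfolding sampling_measure_def
  by (subst integral_distr[OF measurable_uniform_count_id[OF assms(2)] assms(3)])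
     (simp add: integral_uniform_count_measure[OF assms(1)])

text \<open>
  The conventions \<open>0 / 0 = 0\<close> and \<open>y / \<infinity> = 0\<close> of the extended nonnegative reals cover the empty and the infinite
  configurations.
\<close>

lemma emeasure_sampling_measure:
  assumes S: "S \<subseteq> space X" and A: "A \<in> sets X"
  shows "emeasure (sampling_measure X S) A = num_points S A / num_points S (space X)"
proof -
  have vim: "(\<lambda>x. x) -` A \<inter> space (uniform_count_measure S) = S \<inter> A"
    by (auto simp: space_uniform_count_measure)
  have *: "emeasure (sampling_measure X S) A = emeasure (uniform_count_measure S) (S \<inter> A)"
    unfolding sampling_measure_def
    by (subst emeasure_distr[OF measurable_uniform_count_id[OF S] A]) (simp only: vim)
  show ?thesis
  proof (cases "finite S")
    case True
    show ?thesis
    proof (cases "S = {}")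
      case True then show ?thesis
        using * by (simp add: num_points_cases emeasure_uniform_count_measure)
    next
      case False
      then have "card S > 0" using \<open>finite S\<close> by auto
      then show ?thesis
        using True S unfolding * num_points_space[OF S]
        by (simp add: emeasure_uniform_count_measure num_points_finite divide_ennreal ennreal_of_nat_eq_real_of_nat)
    qed
  next
    case False
    have "emeasure (uniform_count_measure S) (S \<inter> A) = 0"
      using False unfolding uniform_count_measure_def
      by (simp add: point_measure_def emeasure_density)
    then show ?thesis
      using False * num_points_space[OF S] by (simp add: ennreal_divide_top)
  qed
qed

lemma measurable_sampling_measure:
  assumes "space X \<noteq> {}"
  shows "sampling_measure X \<in> measurable (config_space X) (subprob_algebra X)"
proof (rule measurable_subprob_algebra)
  fix S assume "S \<in> space (config_space X)"
  then have S: "S \<subseteq> space X" by (simp add: space_config_space)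
  show "sets (sampling_measure X S) = sets X"
    by (simp add: sampling_measure_def)
  show "subprob_space (sampling_measure X S)"
  proof (rule subprob_spaceI)
    have "num_points S (space X) / num_points S (space X) \<le> 1"
      by (cases "num_points S (space X) = 0 \<or> num_points S (space X) = \<infinity>")
         (auto simp: ennreal_divide_self top.not_eq_extremum ennreal_divide_top)
    then show "emeasure (sampling_measure X S) (space (sampling_measure X S)) \<le> 1"
      using emeasure_sampling_measure[OF S sets.top] by (simp add: sampling_measure_def)
  qed (use assms in \<open>simp add: sampling_measure_def\<close>)
next
  fix A assume A: "A \<in> sets X"
  have "(\<lambda>S. num_points S A / num_points S (space X)) \<in> borel_measurable (config_space X)"
    unfolding divide_ennreal_def using A by measurable
  then show "(\<lambda>S. emeasure (sampling_measure X S) A) \<in> borel_measurable (config_space X)"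
    by (subst measurable_cong[OF emeasure_sampling_measure[OF _ A]]) (auto simp: space_config_space)
qed

lemma measurable_integral_kernel:
  fixes f :: "'b \<Rightarrow> 'a \<Rightarrow> real"
  assumes f: "(\<lambda>(x, y). f x y) \<in> borel_measurable (M \<Otimes>\<^sub>M N)"
    and k: "k \<in> measurable M (subprob_algebra N)"
  shows "(\<lambda>x. integral\<^sup>L (k x) (f x)) \<in> borel_measurable M"
proof -
  have "(\<lambda>x. distr (k x) borel (f x)) \<in> measurable M (subprob_algebra borel)"
    using f k by (rule measurable_distr2)
  from measurable_compose[OF this integral_measurable_subprob_algebra[of "\<lambda>y. y"]]
  have "(\<lambda>x. integral\<^sup>L (distr (k x) borel (f x)) (\<lambda>y. y)) \<in> borel_measurable M"
    by simp
  moreover have "integral\<^sup>L (distr (k x) borel (f x)) (\<lambda>y. y) = integral\<^sup>L (k x) (f x)"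
    if x: "x \<in> space M" for x
  proof (rule integral_distr)
    have "f x \<in> borel_measurable N" using measurable_Pair2[OF f x] by simp
    then show "f x \<in> borel_measurable (k x)"
      using subprob_measurableD(2)[OF k x] by (simp cong: measurable_cong_sets)
  qed simp
  ultimately show ?thesis by (subst measurable_cong) auto
qed

text \<open>
  With \<open>c\<close> the number of points, the sum over pairs of distinct points equals
  \<open>c\<^sup>2 \<integral>\<integral> h - c \<integral> h(x, x)\<close>, integrated against the sampling measure, and such integrals depend
  measurably on the configuration. Subtracting the integral of \<open>h(x, x)\<close> replaces the indicator of
  the diagonal, which may be a non-measurable set. For an infinite configuration both
  expressions are \<open>0\<close> by convention.
\<close>

lemma measurable_pair_sum_config:
  fixes h :: "'a \<Rightarrow> 'a \<Rightarrow> real"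
  assumes h: "(\<lambda>(x, y). h x y) \<in> borel_measurable (X \<Otimes>\<^sub>M X)"
  shows "(\<lambda>S. \<Sum>(x, y) \<in> {(x, y). x \<in> S \<and> y \<in> S \<and> x \<noteq> y}. h x y) \<in> borel_measurable (config_space X)"
proof (cases "space X = {}")
  case True
  then have "space (config_space X) = {{}}" by (auto simp: space_config_space)
  then show ?thesis
    by (subst measurable_cong[where g="\<lambda>_. 0"]) auto
next
  case False
  note K = measurable_sampling_measure[OF False]
  let ?K = "sampling_measure X" and ?C = "config_space X"
  have hy: "h x \<in> borel_measurable X" if "x \<in> space X" for x
    using measurable_Pair2[OF h that] by simp
  have hd: "(\<lambda>x. h x x) \<in> borel_measurable X"
    using measurable_compose[OF _ h, of "\<lambda>x. (x, x)" X] by simp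
  have inner: "(\<lambda>(S, x). integral\<^sup>L (?K S) (h x)) \<in> borel_measurable (?C \<Otimes>\<^sub>M X)"
  proof -
    have "(\<lambda>(p, y). h (snd p) y) \<in> borel_measurable ((?C \<Otimes>\<^sub>M X) \<Otimes>\<^sub>M X)"
      using measurable_compose[OF _ h, of "\<lambda>(p, y). (snd p, y)" "(?C \<Otimes>\<^sub>M X) \<Otimes>\<^sub>M X"]
      by (simp add: split_beta')
    note measurable_integral_kernel[OF this, of "\<lambda>p. ?K (fst p)"]
    moreover have "(\<lambda>p. ?K (fst p)) \<in> measurable (?C \<Otimes>\<^sub>M X) (subprob_algebra X)"
      by (rule measurable_compose[OF measurable_fst K])
    ultimately show ?thesis by (simp add: split_beta')
  qed
  have outer: "(\<lambda>S. integral\<^sup>L (?K S) (\<lambda>x. integral\<^sup>L (?K S) (h x))) \<in> borel_measurable ?C"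
    using measurable_integral_kernel[OF inner K] by simp
  have diag: "(\<lambda>S. integral\<^sup>L (?K S) (\<lambda>x. h x x)) \<in> borel_measurable ?C"
    using measurable_compose[OF K integral_measurable_subprob_algebra[OF hd]] by simp
  let ?c = "\<lambda>S. enn2real (num_points S (space X))"
  have "(\<lambda>S. ?c S * ?c S * integral\<^sup>L (?K S) (\<lambda>x. integral\<^sup>L (?K S) (h x))
      - ?c S * integral\<^sup>L (?K S) (\<lambda>x. h x x)) \<in> borel_measurable ?C"
    using outer diag by measurable
  moreover have "?c S * ?c S * integral\<^sup>L (?K S) (\<lambda>x. integral\<^sup>L (?K S) (h x))
      - ?c S * integral\<^sup>L (?K S) (\<lambda>x. h x x)
      = (\<Sum>(x, y) \<in> {(x, y). x \<in> S \<and> y \<in> S \<and> x \<noteq> y}. h x y)"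
    if "S \<in> space ?C" for S
  proof -
    have S: "S \<subseteq> space X" using that by (simp add: space_config_space)
    show ?thesis
    proof (cases "finite S")
      case False
      have "infinite {(x, y). x \<in> S \<and> y \<in> S \<and> x \<noteq> y}"
      proof
        assume fin: "finite {(x, y). x \<in> S \<and> y \<in> S \<and> x \<noteq> y}"
        obtain a where a: "a \<in> S" using False by (metis finite.emptyI ex_in_conv)
        have "S - {a} \<subseteq> fst ` {(x, y). x \<in> S \<and> y \<in> S \<and> x \<noteq> y}"
          using a by (force simp: image_iff)
        then have "finite (S - {a})" using fin finite_surj by blast
        then show False using False by simp
      qed
      then show ?thesis using False by (simp add: num_points_space[OF S])
    next
      case fin: True
      show ?thesis
      proof (cases "S = {}")
        case True then show ?thesis by (simp add: num_points_cases)
      next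
        case False
        have c: "?c S = real (card S)" "card S > 0"
          using fin False by (auto simp: num_points_space[OF S] card_gt_0_iff)
        have inn: "integral\<^sup>L (?K S) (h x) = (\<Sum>y\<in>S. h x y) / real (card S)" if "x \<in> space X" for x
          by (rule sampling_measure_integral[OF fin S hy[OF that]])
        have innm: "(\<lambda>x. (integral\<^sup>L (?K S) (h x))) \<in> borel_measurable X"
          using measurable_compose[OF measurable_Pair1'[OF that] inner] by simp
        have "integral\<^sup>L (?K S) (\<lambda>x. integral\<^sup>L (?K S) (h x))
            = (\<Sum>x\<in>S. (\<Sum>y\<in>S. h x y) / real (card S)) / real (card S)"
          using S by (subst sampling_measure_integral[OF fin S innm]) (auto intro!: sum.cong simp: inn subset_eq)
        moreover have "integral\<^sup>L (?K S) (\<lambda>x. h x x) = (\<Sum>x\<in>S. h x x) / real (card S)"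
          by (rule sampling_measure_integral[OF fin S hd])
        moreover have "(\<Sum>x\<in>S. \<Sum>y\<in>S. h x y)
            = (\<Sum>x\<in>S. h x x) + (\<Sum>(x, y) \<in> {(x, y). x \<in> S \<and> y \<in> S \<and> x \<noteq> y}. h x y)"
        proof -
          have "(\<Sum>x\<in>S. \<Sum>y\<in>S. h x y) = (\<Sum>x\<in>S. h x x + (\<Sum>y\<in>S - {x}. h x y))"
            using fin by (intro sum.cong refl) (simp add: sum.remove)
          also have "\<dots> = (\<Sum>x\<in>S. h x x) + (\<Sum>(x, y)\<in>Sigma S (\<lambda>x. S - {x}). h x y)"
            using fin by (simp add: sum.distrib sum.Sigma)
          also have "Sigma S (\<lambda>x. S - {x}) = {(x, y). x \<in> S \<and> y \<in> S \<and> x \<noteq> y}"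
            by auto
          finally show ?thesis .
        qed
        ultimately show ?thesis
          using c by (simp add: sum_divide_distrib[symmetric])
      qed
    qed
  qed
  ultimately show ?thesis
    by (subst measurable_cong[where g="\<lambda>S. ?c S * ?c S * integral\<^sup>L (?K S) (\<lambda>x. integral\<^sup>L (?K S) (h x))
      - ?c S * integral\<^sup>L (?K S) (\<lambda>x. h x x)"]) auto
qed

text \<open>
  The test statistic as a function of the configuration of marked points; \<open>e\<close> reads the sign off the
  mark.
\<close>

definition marked_stat :: "('a \<Rightarrow> 'a \<Rightarrow> real) \<Rightarrow> ('m \<Rightarrow> real) \<Rightarrow> ('a \<times> 'm) set \<Rightarrow> real" where
  "marked_stat K e \<xi> = (\<Sum>(z, z') \<in> {(z, z'). z \<in> \<xi> \<and> z' \<in> \<xi> \<and> z \<noteq> z'}.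
     K (fst z) (fst z') * e (snd z) * e (snd z'))"

lemma measurable_marked_stat:
  assumes K: "(\<lambda>(x, x'). K x x') \<in> borel_measurable (X \<Otimes>\<^sub>M X)"
    and e: "e \<in> borel_measurable L"
  shows "marked_stat K e \<in> borel_measurable (config_space (X \<Otimes>\<^sub>M L))"
proof -
  let ?Y = "X \<Otimes>\<^sub>M L"
  have "(\<lambda>p. K (fst (fst p)) (fst (snd p))) \<in> borel_measurable (?Y \<Otimes>\<^sub>M ?Y)"
    using measurable_compose[OF _ K, of "\<lambda>p. (fst (fst p), fst (snd p))" "?Y \<Otimes>\<^sub>M ?Y"] by simp
  moreover have "(\<lambda>p. e (snd (fst p))) \<in> borel_measurable (?Y \<Otimes>\<^sub>M ?Y)"
    "(\<lambda>p. e (snd (snd p))) \<in> borel_measurable (?Y \<Otimes>\<^sub>M ?Y)"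
    by (rule measurable_compose[OF _ e], measurable)+
  ultimately have "(\<lambda>(z, z'). K (fst z) (fst z') * e (snd z) * e (snd z')) \<in> borel_measurable (?Y \<Otimes>\<^sub>M ?Y)"
    by (simp add: split_beta')
  from measurable_pair_sum_config[OF this] show ?thesis
    unfolding marked_stat_def[abs_def] .
qed

lemma marked_stat_marked_points:
  "marked_stat K e (marked_points m S) = T_stat K S (\<lambda>x. e (m x))"
proof -
  let ?j = "\<lambda>(x, y). ((x, m x), (y, m y))"
  have inj: "inj_on ?j {(x, y). x \<in> S \<and> y \<in> S \<and> x \<noteq> y}"
    by (auto simp: inj_on_def)
  have im: "{(z, z'). z \<in> marked_points m S \<and> z' \<in> marked_points m S \<and> z \<noteq> z'}
      = ?j ` {(x, y). x \<in> S \<and> y \<in> S \<and> x \<noteq> y}"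
    by (force simp: marked_points_def image_iff)
  show ?thesis
    unfolding marked_stat_def T_stat_def im
    by (subst sum.reindex[OF inj]) (auto intro!: sum.cong)
qed

section \<open>Fine partitions for non-atomic measures\<close>

text \<open>
  Repeatedly cutting a set in two and keeping the smaller part at least halves the measure each time.
\<close>

lemma non_atomic_small_subset:
  assumes M: "finite_measure M" and na: "non_atomic M"
    and A: "A \<in> sets M" "measure M A > 0" and e: "(e::real) > 0"
  obtains D where "D \<in> sets M" "D \<subseteq> A" "0 < measure M D" "measure M D \<le> e"
proof -
  interpret finite_measure M by fact
  have "\<exists>D\<in>sets M. D \<subseteq> A \<and> 0 < measure M D \<and> measure M D \<le> measure M A / 2 ^ k" for k
  proof (induction k)
    case 0 then show ?case using A by auto
  next
    case (Suc k)
    then obtain D where D: "D \<in> sets M" "D \<subseteq> A" "0 < measure M D" "measure M D \<le> measure M A / 2 ^ k"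
      by auto
    then obtain C where C: "C \<in> sets M" "C \<subseteq> D" "0 < emeasure M C" "emeasure M C < emeasure M D"
      using na unfolding non_atomic_def by (auto simp: emeasure_eq_measure)
    then have "0 < measure M C" "measure M C < measure M D"
      by (auto simp: emeasure_eq_measure ennreal_less_iff)
    moreover have "measure M (D - C) = measure M D - measure M C"
      using C D by (simp add: finite_measure_Diff)
    moreover have "x \<le> measure M A / 2 ^ Suc k" if "x \<le> measure M D / 2" for x
      using that D(4) by simp
    ultimately show ?case
    proof (cases "measure M C \<le> measure M D / 2")
      case True
      then show ?thesis
        using C D \<open>0 < measure M C\<close> \<open>\<And>x. x \<le> measure M D / 2 \<Longrightarrow> x \<le> measure M A / 2 ^ Suc k\<close>
        by (intro bexI[of _ C]) auto
    next
      case False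
      then have "measure M (D - C) \<le> measure M D / 2" "0 < measure M (D - C)"
        using \<open>measure M (D - C) = measure M D - measure M C\<close> \<open>measure M C < measure M D\<close> by auto
      then show ?thesis
        using C D \<open>\<And>x. x \<le> measure M D / 2 \<Longrightarrow> x \<le> measure M A / 2 ^ Suc k\<close>
        by (intro bexI[of _ "D - C"]) auto
    qed
  qed
  note small = this
  obtain k where "measure M A / e < 2 ^ k"
    using real_arch_pow[of 2 "measure M A / e"] by auto
  then have "measure M A / 2 ^ k \<le> e" using e by (simp add: field_simps)
  then show ?thesis using small[of k] that by fastforce
qed

definition splits_finely :: "'a measure \<Rightarrow> real \<Rightarrow> 'a set \<Rightarrow> bool" where
  "splits_finely M e C \<longleftrightarrow>
     (\<exists>P. finite P \<and> P \<subseteq> sets M \<and> disjoint P \<and> \<Union>P = C \<and> (\<forall>D\<in>P. measure M D \<le> e))"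

lemma splits_finely_sets: "splits_finely M e C \<Longrightarrow> C \<in> sets M"
  unfolding splits_finely_def by auto

lemma splits_finely_small: "D \<in> sets M \<Longrightarrow> measure M D \<le> e \<Longrightarrow> splits_finely M e D"
  unfolding splits_finely_def by (intro exI[of _ "{D}"]) auto

lemma splits_finely_Un_disjoint:
  assumes "splits_finely M e C" "splits_finely M e D" "C \<inter> D = {}"
  shows "splits_finely M e (C \<union> D)"
proof -
  obtain P Q where P: "finite P" "P \<subseteq> sets M" "disjoint P" "\<Union>P = C" "\<forall>D\<in>P. measure M D \<le> e"
    and Q: "finite Q" "Q \<subseteq> sets M" "disjoint Q" "\<Union>Q = D" "\<forall>D\<in>Q. measure M D \<le> e"
    using assms unfolding splits_finely_def by metis
  have "disjoint (P \<union> Q)"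
    using P Q assms(3) by (intro disjoint_union) auto
  then show ?thesis
    unfolding splits_finely_def using P Q by (intro exI[of _ "P \<union> Q"]) auto
qed

lemma splits_finely_Diff:
  assumes "finite_measure M" "splits_finely M e C" "D \<in> sets M"
  shows "splits_finely M e (C - D)"
proof -
  interpret finite_measure M by fact
  obtain P where P: "finite P" "P \<subseteq> sets M" "disjoint P" "\<Union>P = C" "\<forall>D\<in>P. measure M D \<le> e"
    using assms unfolding splits_finely_def by metis
  have "measure M (E - D) \<le> e" if "E \<in> P" for E
    using P that finite_measure_mono[of "E - D" E] by fastforce
  moreover have "disjoint ((\<lambda>E. E - D) ` P)"
    using P(3) unfolding disjoint_def by blast
  ultimately show ?thesis
    unfolding splits_finely_def using P assms(3) by (intro exI[of _ "(\<lambda>E. E - D) ` P"]) auto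
qed

lemma splits_finely_Un:
  assumes "finite_measure M" "splits_finely M e C" "splits_finely M e D"
  shows "splits_finely M e (C \<union> D)"
  using splits_finely_Un_disjoint[OF assms(2) splits_finely_Diff[OF assms(1,3) splits_finely_sets[OF assms(2)]]]
  by simp

text \<open>
  Exhaustion. The finely splitting sets are closed under finite unions, and also under increasing
  countable unions, since a tail of small measure is one more cell. So some finely splitting set
  has maximal measure; a small subset of its complement could be added, hence the complement is
  null and is itself a cell.
\<close>

lemma non_atomic_splits_finely:
  assumes M: "finite_measure M" and na: "non_atomic M" and e: "e > 0"
  shows "splits_finely M e (space M)"
proof -
  interpret finite_measure M by fact
  let ?V = "measure M ` {C. splits_finely M e C}"
  define s where "s = Sup ?V"
  have bdd: "bdd_above ?V"
    by (intro bdd_aboveI[of _ "measure M (space M)"]) (auto intro: bounded_measure)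
  have "splits_finely M e {}" using e by (intro splits_finely_small) auto
  then have ne: "?V \<noteq> {}" by auto
  have "\<exists>C. splits_finely M e C \<and> s - 1 / real (Suc k) < measure M C" for k
    using less_cSup_iff[OF ne bdd, of "s - 1 / real (Suc k)"] by (auto simp: s_def)
  then obtain C where C: "\<And>k. splits_finely M e (C k)" "\<And>k. s - 1 / real (Suc k) < measure M (C k)"
    by metis
  \<comment> \<open>Unions keep the measures close to the supremum and make the sequence increasing.\<close>
  define U where "U k = (\<Union>i\<le>k. C i)" for k
  have U: "splits_finely M e (U k)" for k
  proof (induction k)
    case (Suc k)
    then show ?case
      using splits_finely_Un[OF M Suc C(1)[of "Suc k"]] by (simp add: U_def atMost_Suc Un_commute)
  qed (simp add: U_def C)
  have Us: "U k \<in> sets M" for k using splits_finely_sets[OF U] .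
  have inc: "incseq U" by (force simp: U_def incseq_def)
  have lim: "(\<lambda>k. measure M (U k)) \<longlonglongrightarrow> measure M (\<Union>k. U k)"
    by (rule finite_Lim_measure_incseq) (use Us inc in auto)
  let ?U = "\<Union>k. U k"
  have Uset: "?U \<in> sets M" using Us by auto
  have "\<forall>\<^sub>F k in sequentially. measure M ?U - e < measure M (U k)"
    using order_tendstoD(1)[OF lim, of "measure M ?U - e"] e by simp
  then obtain k where "measure M ?U - e < measure M (U k)"
    by (auto simp: eventually_sequentially)
  then have "measure M (?U - U k) \<le> e"
    using Us Uset by (subst finite_measure_Diff) auto
  then have "splits_finely M e (U k \<union> (?U - U k))"
    using Us Uset by (intro splits_finely_Un_disjoint U splits_finely_small) auto
  moreover have "U k \<union> (?U - U k) = ?U" by auto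
  ultimately have Usplit: "splits_finely M e ?U" by simp
  have "s \<le> measure M ?U"
  proof (rule field_le_epsilon)
    fix d :: real assume "d > 0"
    then obtain k where k: "1 / real (Suc k) < d" using nat_approx_posE by auto
    have "measure M (C k) \<le> measure M ?U"
      using Uset by (intro finite_measure_mono) (auto simp: U_def)
    then show "s \<le> measure M ?U + d" using C(2)[of k] k by linarith
  qed
  have "measure M (space M - ?U) = 0"
  proof (rule ccontr)
    assume "measure M (space M - ?U) \<noteq> 0"
    then have pos: "measure M (space M - ?U) > 0" by (simp add: zero_less_measure_iff)
    obtain D where D: "D \<in> sets M" "D \<subseteq> space M - ?U" "0 < measure M D" "measure M D \<le> e"
      using non_atomic_small_subset[OF M na _ pos e] Uset by blast
    have "splits_finely M e (?U \<union> D)"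
      using D by (intro splits_finely_Un_disjoint Usplit splits_finely_small) auto
    then have "measure M (?U \<union> D) \<le> s"
      unfolding s_def by (intro cSup_upper bdd) auto
    moreover have "measure M (?U \<union> D) = measure M ?U + measure M D"
      using D Uset by (intro finite_measure_Union) auto
    ultimately show False using D \<open>s \<le> measure M ?U\<close> by simp
  qed
  then have "splits_finely M e (?U \<union> (space M - ?U))"
    using Uset e by (intro splits_finely_Un_disjoint Usplit splits_finely_small) auto
  moreover have "?U \<union> (space M - ?U) = space M"
    using sets.sets_into_space[OF Uset] by auto
  ultimately show ?thesis by simp
qed

text \<open>
  A set of positive density measure is cut inside the part where the density is positive; there
  both pieces have positive density measure. Finiteness turns this into strict inequality.
\<close>

lemma non_atomic_density:
  assumes na: "non_atomic \<nu>" and h: "h \<in> borel_measurable \<nu>"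
    and fin: "finite_measure (density \<nu> h)"
  shows "non_atomic (density \<nu> h)"
  unfolding non_atomic_def
proof (intro ballI impI)
  interpret finite_measure "density \<nu> h" by fact
  have nz: "0 < y \<longleftrightarrow> y \<noteq> 0" for y :: ennreal
    by (rule zero_less_iff_neq_zero)
  have pos_iff: "emeasure (density \<nu> h) A > 0 \<longleftrightarrow> emeasure \<nu> (A \<inter> {x\<in>space \<nu>. h x > 0}) > 0"
    if A: "A \<in> sets \<nu>" for A
  proof -
    have Z: "A \<inter> {x\<in>space \<nu>. h x > 0} \<in> sets \<nu>" using A h by measurable
    have "emeasure (density \<nu> h) A = 0 \<longleftrightarrow> (AE x in \<nu>. h x * indicator A x = 0)"
      using A h by (simp add: emeasure_density nn_integral_0_iff_AE)
    also have "\<dots> \<longleftrightarrow> (AE x in \<nu>. x \<notin> A \<inter> {x\<in>space \<nu>. h x > 0})"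
      by (intro AE_cong) (auto simp: indicator_def nz)
    also have "\<dots> \<longleftrightarrow> emeasure \<nu> (A \<inter> {x\<in>space \<nu>. h x > 0}) = 0"
      using AE_iff_null_sets[OF Z] Z by auto
    finally show ?thesis by (simp add: zero_less_iff_neq_zero)
  qed
  fix A assume "A \<in> sets (density \<nu> h)" and pA: "0 < emeasure (density \<nu> h) A"
  then have A: "A \<in> sets \<nu>" by simp
  let ?S = "{x\<in>space \<nu>. h x > 0}"
  have S: "?S \<in> sets \<nu>" using h by measurable
  obtain C where C: "C \<in> sets \<nu>" "C \<subseteq> A \<inter> ?S" "0 < emeasure \<nu> C" "emeasure \<nu> C < emeasure \<nu> (A \<inter> ?S)"
  proof -
    have "A \<inter> ?S \<in> sets \<nu>" "0 < emeasure \<nu> (A \<inter> ?S)"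
      using A S pA pos_iff[OF A] by auto
    then show thesis using na that unfolding non_atomic_def by blast
  qed
  have "C \<inter> ?S = C" using C by auto
  then have pC: "0 < emeasure (density \<nu> h) C" using C by (simp add: pos_iff)
  have "0 < emeasure \<nu> ((A - C) \<inter> ?S)"
  proof (rule ccontr)
    assume "\<not> ?thesis"
    then have "emeasure \<nu> ((A - C) \<inter> ?S) = 0" by (simp add: zero_less_iff_neq_zero)
    moreover have "(A - C) \<inter> ?S \<in> sets \<nu>" using A S C by auto
    then have "emeasure \<nu> (C \<union> ((A - C) \<inter> ?S)) \<le> emeasure \<nu> C + emeasure \<nu> ((A - C) \<inter> ?S)"
      by (rule emeasure_subadditive[OF C(1)])
    moreover have "C \<union> ((A - C) \<inter> ?S) = A \<inter> ?S" using C by auto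
    ultimately have "emeasure \<nu> (A \<inter> ?S) \<le> emeasure \<nu> C"
      by simp
    then show False using C by simp
  qed
  then have pD: "0 < emeasure (density \<nu> h) (A - C)"
    using A C by (subst pos_iff) auto
  have "measure (density \<nu> h) (A - C) = measure (density \<nu> h) A - measure (density \<nu> h) C"
    using A C by (intro finite_measure_Diff) auto
  then have "measure (density \<nu> h) C < measure (density \<nu> h) A"
    using pD by (simp add: emeasure_eq_measure)
  then show "\<exists>C\<in>sets (density \<nu> h). C \<subseteq> A \<and> 0 < emeasure (density \<nu> h) C \<and>
      emeasure (density \<nu> h) C < emeasure (density \<nu> h) A"
    using C pC by (intro bexI[of _ C]) (auto simp: emeasure_eq_measure ennreal_less_iff)
qed

lemma intensity_measure_eq_density:
  assumes "h \<in> borel_measurable \<nu>"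
  shows "intensity_measure n \<nu> h = density \<nu> (\<lambda>x. ennreal n * ennreal (h x))"
  unfolding intensity_measure_def
proof (rule measure_eqI)
  fix A assume "A \<in> sets (density (scale_measure (ennreal n) \<nu>) (\<lambda>x. ennreal (h x)))"
  then have A: "A \<in> sets \<nu>" by simp
  then show "emeasure (density (scale_measure (ennreal n) \<nu>) (\<lambda>x. ennreal (h x))) A
      = emeasure (density \<nu> (\<lambda>x. ennreal n * ennreal (h x))) A"
    using assms
    by (simp add: emeasure_density nn_integral_scale_measure nn_integral_cmult[symmetric] mult.assoc
        cong: measurable_cong_sets)
qed simp

lemma space_intensity_measure [simp]: "space (intensity_measure n \<nu> h) = space \<nu>"
  and sets_intensity_measure [simp, measurable_cong]: "sets (intensity_measure n \<nu> h) = sets \<nu>"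
  unfolding intensity_measure_def by (auto simp: space_scale_measure)

lemma finite_intensity_measure:
  assumes "integrable \<nu> h"
  shows "finite_measure (intensity_measure n \<nu> h)"
proof (rule finite_measureI)
  have [measurable]: "h \<in> borel_measurable \<nu>" using assms by auto
  have "(\<integral>\<^sup>+x. ennreal (h x) \<partial>\<nu>) \<le> (\<integral>\<^sup>+x. ennreal (norm (h x)) \<partial>\<nu>)"
    by (intro nn_integral_mono ennreal_leI) auto
  also have "\<dots> < \<infinity>" using assms by (simp add: integrable_iff_bounded)
  finally have "ennreal n * (\<integral>\<^sup>+x. ennreal (h x) \<partial>\<nu>) < \<infinity>" by (simp add: ennreal_mult_less_top)
  then show "emeasure (intensity_measure n \<nu> h) (space (intensity_measure n \<nu> h)) \<noteq> \<infinity>"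
    by (simp add: intensity_measure_eq_density nn_integral_cmult emeasure_density
        cong: nn_integral_cong_simp)
qed

lemma non_atomic_intensity_measure:
  assumes "non_atomic \<nu>" "integrable \<nu> h"
  shows "non_atomic (intensity_measure n \<nu> h)"
proof -
  have [measurable]: "h \<in> borel_measurable \<nu>" using assms(2) by auto
  show ?thesis
    using finite_intensity_measure[OF assms(2), of n] assms(1)
    by (simp add: intensity_measure_eq_density non_atomic_density)
qed

lemma intensity_measure_cong:
  assumes "f \<in> borel_measurable \<nu>" "g \<in> borel_measurable \<nu>" "\<And>x. x \<in> space \<nu> \<Longrightarrow> f x = g x"
  shows "intensity_measure n \<nu> f = intensity_measure n \<nu> g"
proof -
  have "density \<nu> (\<lambda>x. ennreal n * ennreal (f x)) = density \<nu> (\<lambda>x. ennreal n * ennreal (g x))"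
  proof (rule density_cong)
    show "AE x in \<nu>. ennreal n * ennreal (f x) = ennreal n * ennreal (g x)"
      by (rule AE_I2) (simp only: assms(3))
  qed (use assms(1,2) in measurable)
  then show ?thesis using assms(1,2) by (simp add: intensity_measure_eq_density)
qed

section \<open>Avoidance probabilities determine the law\<close>

text \<open>
  A sequence is taken because in general no single finite partition separates the points of almost every
  configuration.
\<close>

definition separating :: "'a measure \<Rightarrow> (nat \<Rightarrow> 'a set set) \<Rightarrow> bool" where
  "separating X P \<longleftrightarrow> (\<forall>k. finite (P k) \<and> P k \<subseteq> sets X \<and> disjoint (P k) \<and> \<Union>(P k) = space X)"

definition separated_by :: "(nat \<Rightarrow> 'a set set) \<Rightarrow> 'a set \<Rightarrow> bool" where
  "separated_by P S \<longleftrightarrow> (\<exists>k. \<forall>D\<in>P k. num_points S D \<le> 1)"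

lemma num_points_partition:
  assumes "finite P" "disjoint P" "S \<subseteq> \<Union>P"
  shows "num_points S E = (\<Sum>D\<in>P. num_points S (E \<inter> D))"
proof -
  have "(\<Sum>D\<in>P. emeasure (count_space UNIV) (S \<inter> (E \<inter> D)))
      = emeasure (count_space UNIV) (\<Union>D\<in>P. S \<inter> (E \<inter> D))"
    using assms by (intro sum_emeasure) (auto simp: disjoint_family_on_def disjoint_def)
  moreover have "(\<Union>D\<in>P. S \<inter> (E \<inter> D)) = S \<inter> E" using assms(3) by auto
  ultimately show ?thesis by (simp add: num_points_def)
qed

lemma num_points_mono: "A \<subseteq> A' \<Longrightarrow> num_points S A \<le> num_points S A'"
  unfolding num_points_def by (intro emeasure_mono) auto

lemma of_bool_le_num_points: "of_bool (S \<inter> A \<noteq> {}) \<le> num_points S A"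
proof (cases "S \<inter> A = {}")
  case False
  then obtain x where "x \<in> S \<inter> A" by auto
  then have "emeasure (count_space UNIV) {x} \<le> num_points S A"
    unfolding num_points_def by (intro emeasure_mono) auto
  then show ?thesis using False by simp
qed simp

text \<open>
  The number of cells hit never exceeds the number of points, and equals it for a partition with at
  most one point in each cell.
\<close>

lemma num_points_eq_SUP_hits:
  assumes P: "separating X P" and S: "S \<subseteq> space X" "separated_by P S"
  shows "num_points S E = (SUP k. \<Sum>D\<in>P k. of_bool (S \<inter> (E \<inter> D) \<noteq> {}))"
proof (rule antisym)
  have part: "num_points S E = (\<Sum>D\<in>P k. num_points S (E \<inter> D))" for k
    using P S by (intro num_points_partition) (auto simp: separating_def)
  obtain k where k: "\<And>D. D \<in> P k \<Longrightarrow> num_points S D \<le> 1"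
    using S(2) unfolding separated_by_def by auto
  have "num_points S (E \<inter> D) = of_bool (S \<inter> (E \<inter> D) \<noteq> {})" if "D \<in> P k" for D
  proof -
    have "num_points S (E \<inter> D) \<le> 1"
      using k[OF that] num_points_mono[of "E \<inter> D" D S] by (meson Int_lower2 order_trans)
    then show ?thesis
      using of_bool_le_num_points[of S "E \<inter> D"] num_points_eq_0_iff[of S "E \<inter> D"]
      by (cases "S \<inter> (E \<inter> D) = {}") auto
  qed
  then have "num_points S E = (\<Sum>D\<in>P k. of_bool (S \<inter> (E \<inter> D) \<noteq> {}))"
    unfolding part[of k] by (intro sum.cong) auto
  then show "num_points S E \<le> (SUP k. \<Sum>D\<in>P k. of_bool (S \<inter> (E \<inter> D) \<noteq> {}))"
    by (intro SUP_upper2[of k]) simp_all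
  show "(SUP k. \<Sum>D\<in>P k. of_bool (S \<inter> (E \<inter> D) \<noteq> {})) \<le> num_points S E"
  proof (rule SUP_least)
    fix k show "(\<Sum>D\<in>P k. of_bool (S \<inter> (E \<inter> D) \<noteq> {})) \<le> num_points S E"
      unfolding part[of k] by (intro sum_mono of_bool_le_num_points)
  qed
qed

text \<open>
  Avoidance events are stable under intersection, because avoiding \<open>E\<close> and \<open>E'\<close> is avoiding \<open>E \<union> E'\<close>.
  So the two laws agree on the \<open>\<sigma>\<close>-algebra generated by these events. By
  \<open>num_points_eq_SUP_hits\<close>, this \<open>\<sigma>\<close>-algebra has the same trace as the one generated by all counts
  on the separated configurations, which carry both laws.
\<close>

lemma law_determined_by_avoidance:
  assumes M: "prob_space M"
    and \<xi>: "\<xi> \<in> measurable M (config_space X)" "AE \<omega> in M. separated_by P (\<xi> \<omega>)"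
    and \<xi>': "\<xi>' \<in> measurable M (config_space X)" "AE \<omega> in M. separated_by P (\<xi>' \<omega>)"
    and P: "separating X P"
    and avoid: "\<And>E. E \<in> sets X \<Longrightarrow>
      measure M {\<omega>\<in>space M. \<xi> \<omega> \<inter> E = {}} = measure M {\<omega>\<in>space M. \<xi>' \<omega> \<inter> E = {}}"
    and F: "F \<in> sets (config_space X)"
  shows "measure M {\<omega>\<in>space M. \<xi> \<omega> \<in> F} = measure M {\<omega>\<in>space M. \<xi>' \<omega> \<in> F}"
proof -
  interpret prob_space M by fact
  let ?C = "config_space X"
  let ?\<Omega> = "space ?C"
  define \<A> where "\<A> = {{S \<in> ?\<Omega>. S \<inter> E = {}} | E. E \<in> sets X}"
  define V where "V = sigma ?\<Omega> \<A>"
  have \<A>: "\<A> \<subseteq> Pow ?\<Omega>" by (auto simp: \<A>_def)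
  have V: "space V = ?\<Omega>" "sets V = sigma_sets ?\<Omega> \<A>"
    using \<A> by (auto simp: V_def)
  have avoidC: "{S \<in> ?\<Omega>. S \<inter> E = {}} \<in> sets ?C" if "E \<in> sets X" for E
  proof -
    have "{S \<in> ?\<Omega>. num_points S E = 0} \<in> sets ?C"
      using measurable_num_points[OF that] by measurable
    then show ?thesis by (simp add: num_points_eq_0_iff)
  qed
  have toV: "\<eta> \<in> measurable M V" if "\<eta> \<in> measurable M ?C" for \<eta>
    unfolding V_def
  proof (rule measurable_measure_of[OF \<A>])
    show "\<eta> \<in> space M \<rightarrow> ?\<Omega>" using measurable_space[OF that] by auto
    show "\<eta> -` A \<inter> space M \<in> sets M" if "A \<in> \<A>" for A
      using measurable_sets[OF \<open>\<eta> \<in> measurable M ?C\<close>] avoidC that by (auto simp: \<A>_def)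
  qed
  have eqV: "distr M V \<xi> = distr M V \<xi>'"
  proof (rule measure_eqI_generator_eq[where \<Omega>="?\<Omega>" and E="\<A>" and A="\<lambda>_. ?\<Omega>"])
    show "Int_stable \<A>"
    proof (rule Int_stableI)
      fix a b assume "a \<in> \<A>" "b \<in> \<A>"
      then obtain E E' where "E \<in> sets X" "E' \<in> sets X"
        "a = {S \<in> ?\<Omega>. S \<inter> E = {}}" "b = {S \<in> ?\<Omega>. S \<inter> E' = {}}"
        by (auto simp: \<A>_def)
      then have "a \<inter> b = {S \<in> ?\<Omega>. S \<inter> (E \<union> E') = {}}" "E \<union> E' \<in> sets X" by auto
      then show "a \<inter> b \<in> \<A>" unfolding \<A>_def by blast
    qed
  next
    fix a assume "a \<in> \<A>"
    then obtain E where E: "E \<in> sets X" and a: "a = {S \<in> ?\<Omega>. S \<inter> E = {}}" by (auto simp: \<A>_def)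
    have "a \<in> sets V" using \<open>a \<in> \<A>\<close> V by auto
    have pre: "\<eta> -` a \<inter> space M = {\<omega>\<in>space M. \<eta> \<omega> \<inter> E = {}}" if "\<eta> \<in> measurable M ?C" for \<eta>
      using measurable_space[OF that] by (auto simp: a)
    show "emeasure (distr M V \<xi>) a = emeasure (distr M V \<xi>') a"
      using avoid[OF E] \<open>a \<in> sets V\<close> \<xi>(1) \<xi>'(1)
      by (simp add: emeasure_distr toV pre emeasure_eq_measure)
  next
    have "?\<Omega> = {S \<in> ?\<Omega>. S \<inter> {} = {}}" by auto
    then show "range (\<lambda>_::nat. ?\<Omega>) \<subseteq> \<A>" unfolding \<A>_def by blast
  next
    interpret D: prob_space "distr M V \<xi>" using toV[OF \<xi>(1)] by (rule prob_space_distr)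
    show "emeasure (distr M V \<xi>) ?\<Omega> \<noteq> \<infinity>" by simp
  qed (use \<A> V in auto)
  define G where "G = {S \<in> ?\<Omega>. separated_by P S}"
  have "(\<lambda>S. S) \<in> measurable (restrict_space V G) ?C"
  proof (rule measurable_config_spaceI)
    show "S \<in> ?\<Omega>" if "S \<in> space (restrict_space V G)" for S
      using that by (auto simp: space_restrict_space V)
  next
    fix E assume E: "E \<in> sets X"
    have hit: "(\<lambda>S. of_bool (S \<inter> (E \<inter> D) \<noteq> {}) :: ennreal) \<in> borel_measurable V" if "D \<in> P k" for D k
    proof -
      have "D \<in> sets X" using that P by (auto simp: separating_def)
      then have "{S \<in> ?\<Omega>. S \<inter> (E \<inter> D) = {}} \<in> \<A>"
        using E unfolding \<A>_def by (intro CollectI exI[of _ "E \<inter> D"]) auto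
      then have "{S \<in> space V. S \<inter> (E \<inter> D) = {}} \<in> sets V"
        using V by auto
      then have "Measurable.pred V (\<lambda>S. S \<inter> (E \<inter> D) = {})"
        by (simp add: pred_def)
      then show ?thesis by measurable
    qed
    have "(\<lambda>S. SUP k. \<Sum>D\<in>P k. of_bool (S \<inter> (E \<inter> D) \<noteq> {}) :: ennreal) \<in> borel_measurable V"
      by (intro borel_measurable_SUP borel_measurable_sum hit) auto
    then have "(\<lambda>S. SUP k. \<Sum>D\<in>P k. of_bool (S \<inter> (E \<inter> D) \<noteq> {}) :: ennreal)
        \<in> borel_measurable (restrict_space V G)"
      by (rule measurable_restrict_space1)
    then show "(\<lambda>S. num_points S E) \<in> borel_measurable (restrict_space V G)"
      by (subst measurable_cong[OF num_points_eq_SUP_hits[OF P]])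
         (auto simp: space_restrict_space G_def V space_config_space)
  qed
  from measurable_sets[OF this F] obtain F' where F': "F' \<in> sets V" "F \<inter> G = F' \<inter> G"
  proof -
    have "F \<subseteq> ?\<Omega>" using F sets.sets_into_space by auto
    then have "(\<lambda>S. S) -` F \<inter> space (restrict_space V G) = F \<inter> G"
      by (auto simp: space_restrict_space V G_def)
    then show thesis
      using measurable_sets[OF \<open>(\<lambda>S. S) \<in> measurable (restrict_space V G) ?C\<close> F] that
      by (auto simp: sets_restrict_space)
  qed
  have "measure M {\<omega>\<in>space M. \<eta> \<omega> \<in> F} = measure (distr M V \<eta>) F'"
    if \<eta>: "\<eta> \<in> measurable M ?C" "AE \<omega> in M. separated_by P (\<eta> \<omega>)" for \<eta>
  proof -
    have "AE \<omega> in M. \<eta> \<omega> \<in> F \<longleftrightarrow> \<eta> \<omega> \<in> F'"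
      using \<eta>(2) AE_space
    proof eventually_elim
      case (elim \<omega>)
      then have "\<eta> \<omega> \<in> G" using measurable_space[OF \<eta>(1)] by (auto simp: G_def)
      then show ?case using F'(2) by auto
    qed
    then have "measure M {\<omega>\<in>space M. \<eta> \<omega> \<in> F} = measure M {\<omega>\<in>space M. \<eta> \<omega> \<in> F'}"
      using measurable_sets[OF \<eta>(1) F] measurable_sets[OF toV[OF \<eta>(1)] F'(1)]
      by (intro finite_measure_eq_AE) (auto simp: vimage_def Int_def conj_commute)
    also have "\<dots> = measure (distr M V \<eta>) F'"
      using F'(1) toV[OF \<eta>(1)] by (simp add: measure_distr vimage_def Int_def conj_commute)
    finally show ?thesis .
  qed
  then show ?thesis using \<xi> \<xi>' eqV by simp
qed

section \<open>Two independent Poisson processes with the same intensity\<close>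

lemma separatingD:
  assumes "separating X P"
  shows "finite (P k)" "P k \<subseteq> sets X" "disjoint (P k)" "\<Union>(P k) = space X"
  using assms unfolding separating_def by blast+

lemma separated_by_finite:
  assumes P: "separating X P" and S: "S \<subseteq> space X" "separated_by P S"
  shows "finite S"
proof -
  obtain k where k: "\<And>D. D \<in> P k \<Longrightarrow> num_points S D \<le> 1"
    using S(2) unfolding separated_by_def by auto
  have "S = (\<Union>D\<in>P k. S \<inter> D)" using S(1) separatingD(4)[OF P, of k] by auto
  moreover have "finite (\<Union>D\<in>P k. S \<inter> D)"
    using k separatingD(1)[OF P, of k] by (intro finite_UN_I) (auto simp: num_points_le_1_iff)
  ultimately show ?thesis by simp
qed

text \<open>
  The series is the function of the count given by \<open>u\<close>, extended by \<open>0\<close> to an infinite count. This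
  form gives both the almost sure finiteness of the count and the expectation of \<open>half_power\<close> at the count.
\<close>

lemma (in prob_space) poisson_process_expectation:
  assumes N: "poisson_process M \<Lambda> N" and \<Lambda>: "finite_measure \<Lambda>" and A: "A \<in> sets \<Lambda>"
    and u: "\<And>k. 0 \<le> u k" "(\<lambda>k. u k * (exp (- measure \<Lambda> A) * measure \<Lambda> A ^ k / fact k)) sums s"
  shows "(\<integral>\<^sup>+\<omega>. (\<Sum>k. ennreal (u k) * indicator {\<omega>\<in>space M. num_points (N \<omega>) A = of_nat k} \<omega>) \<partial>M) = ennreal s"
proof -
  interpret \<Lambda>: finite_measure \<Lambda> by fact
  have Nm: "N \<in> measurable M (config_space \<Lambda>)"
    and pr: "prob {\<omega>\<in>space M. num_points (N \<omega>) A = of_nat k} = exp (- measure \<Lambda> A) * measure \<Lambda> A ^ k / fact k" for k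
    using N A unfolding poisson_process_def by (auto simp: less_top[symmetric])
  have [measurable]: "(\<lambda>\<omega>. num_points (N \<omega>) A) \<in> borel_measurable M"
    using measurable_compose[OF Nm measurable_num_points[OF A]] .
  have "(\<integral>\<^sup>+\<omega>. (\<Sum>k. ennreal (u k) * indicator {\<omega>\<in>space M. num_points (N \<omega>) A = of_nat k} \<omega>) \<partial>M)
      = (\<Sum>k. \<integral>\<^sup>+\<omega>. ennreal (u k) * indicator {\<omega>\<in>space M. num_points (N \<omega>) A = of_nat k} \<omega> \<partial>M)"
    by (intro nn_integral_suminf) measurable
  also have "\<dots> = (\<Sum>k. ennreal (u k * (exp (- measure \<Lambda> A) * measure \<Lambda> A ^ k / fact k)))"
    using u(1) by (intro suminf_cong)
      (simp add: nn_integral_cmult_indicator emeasure_eq_measure pr ennreal_mult[symmetric])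
  also have "\<dots> = ennreal s"
    using u by (intro suminf_ennreal_eq) auto
  finally show ?thesis .
qed

lemma poisson_weights_sums:
  "(\<lambda>k. c ^ k * (exp (- l) * l ^ k / fact k)) sums exp (- (1 - c) * l)" for c l :: real
proof -
  have "(\<lambda>k. exp (- l) * ((c * l) ^ k /\<^sub>R fact k)) sums (exp (- l) * exp (c * l))"
    by (intro sums_mult exp_converges)
  moreover have "exp (- l) * exp (c * l) = exp (- (1 - c) * l)"
    by (simp add: exp_add[symmetric] algebra_simps)
  moreover have "exp (- l) * ((c * l) ^ k /\<^sub>R fact k) = c ^ k * (exp (- l) * l ^ k / fact k)" for k
    by (simp add: power_mult_distrib field_simps)
  ultimately show ?thesis by simp
qed

lemma (in prob_space) poisson_process_AE_finite:
  assumes N: "poisson_process M \<Lambda> N" and \<Lambda>: "finite_measure \<Lambda>" and A: "A \<in> sets \<Lambda>"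
  shows "AE \<omega> in M. num_points (N \<omega>) A < \<infinity>"
proof -
  have Nm: "N \<in> measurable M (config_space \<Lambda>)" using N by (simp add: poisson_process_def)
  have [measurable]: "(\<lambda>\<omega>. num_points (N \<omega>) A) \<in> borel_measurable M"
    using measurable_compose[OF Nm measurable_num_points[OF A]] .
  let ?E = "\<lambda>k. {\<omega>\<in>space M. num_points (N \<omega>) A = of_nat k}"
  have eq: "(\<Sum>k. ennreal 1 * indicator (?E k) \<omega>) = indicator {\<omega>\<in>space M. num_points (N \<omega>) A < \<infinity>} \<omega>"
    if "\<omega> \<in> space M" for \<omega>
  proof -
    have "disjoint_family ?E" by (auto simp: disjoint_family_on_def)
    then have "(\<Sum>k. indicator (?E k) \<omega> :: ennreal) = indicator (\<Union>k. ?E k) \<omega>"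
      by (rule suminf_indicator)
    moreover have "(\<Union>k. ?E k) = {\<omega>\<in>space M. num_points (N \<omega>) A < \<infinity>}"
      by (auto simp: num_points_cases ennreal_of_nat_eq_real_of_nat split: if_splits)
    ultimately show ?thesis by simp
  qed
  have "(\<integral>\<^sup>+\<omega>. (\<Sum>k. ennreal 1 * indicator (?E k) \<omega>) \<partial>M) = ennreal 1"
    using poisson_weights_sums[of 1 "measure \<Lambda> A"]
    by (intro poisson_process_expectation[OF N \<Lambda> A]) simp_all
  also have "(\<integral>\<^sup>+\<omega>. (\<Sum>k. ennreal 1 * indicator (?E k) \<omega>) \<partial>M)
      = emeasure M {\<omega>\<in>space M. num_points (N \<omega>) A < \<infinity>}"
    by (subst nn_integral_cong[OF eq]) (simp_all add: nn_integral_indicator)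
  finally show ?thesis
    by (intro AE_I_eq_1) (auto simp: ennreal_1)
qed

text \<open>
  The function \<open>k \<mapsto> 2^(-k)\<close> on counts: the probability that \<open>k\<close> fair signs all have prescribed values.
\<close>

definition half_power :: "ennreal \<Rightarrow> real" where
  "half_power b = 2 powr (- enn2real b)"

lemma half_power_of_nat: "half_power (of_nat k) = (1 / 2) ^ k"
  by (simp add: half_power_def powr_minus powr_realpow power_divide inverse_eq_divide)

lemma measurable_half_power [measurable]: "half_power \<in> borel_measurable borel"
  unfolding half_power_def[abs_def] by measurable

lemma half_power_bounds: "0 \<le> half_power b" "half_power b \<le> 1"
  using powr_mono[of "- enn2real b" 0 2] by (auto simp: half_power_def)

lemma (in prob_space) poisson_process_half_power:
  assumes N: "poisson_process M \<Lambda> N" and \<Lambda>: "finite_measure \<Lambda>" and A: "A \<in> sets \<Lambda>"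
  shows "expectation (\<lambda>\<omega>. half_power (num_points (N \<omega>) A)) = exp (- measure \<Lambda> A / 2)"
proof -
  have Nm: "N \<in> measurable M (config_space \<Lambda>)" using N by (simp add: poisson_process_def)
  have [measurable]: "(\<lambda>\<omega>. num_points (N \<omega>) A) \<in> borel_measurable M"
    using measurable_compose[OF Nm measurable_num_points[OF A]] .
  let ?E = "\<lambda>k. {\<omega>\<in>space M. num_points (N \<omega>) A = of_nat k}"
  have "(\<integral>\<^sup>+\<omega>. ennreal (half_power (num_points (N \<omega>) A)) \<partial>M)
      = (\<integral>\<^sup>+\<omega>. (\<Sum>k. ennreal ((1/2) ^ k) * indicator (?E k) \<omega>) \<partial>M)"
  proof (rule nn_integral_cong_AE)
    show "AE \<omega> in M. ennreal (half_power (num_points (N \<omega>) A))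
        = (\<Sum>k. ennreal ((1/2) ^ k) * indicator (?E k) \<omega>)"
      using poisson_process_AE_finite[OF assms] AE_space
    proof eventually_elim
      case (elim \<omega>)
      then obtain j where j: "num_points (N \<omega>) A = of_nat j"
        by (auto simp: num_points_cases split: if_splits)
      then have "ennreal ((1/2) ^ k) * indicator (?E k) \<omega> = (if k = j then ennreal ((1/2) ^ j) else 0)" for k
        using elim by auto
      then show ?case
        using j suminf_finite[of "{j}" "\<lambda>k. if k = j then ennreal ((1/2) ^ j) else 0"]
        by (simp add: half_power_of_nat)
    qed
  qed
  also have "\<dots> = ennreal (exp (- measure \<Lambda> A / 2))"
    using poisson_weights_sums[of "1/2" "measure \<Lambda> A"]
    by (intro poisson_process_expectation[OF N \<Lambda> A]) simp_all
  finally show ?thesis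
    using half_power_bounds by (intro nn_integral_eq_integrable[THEN iffD1, THEN conjunct2]) auto
qed

lemma (in prob_space) poisson_process_avoid:
  assumes N: "poisson_process M \<Lambda> N" and \<Lambda>: "finite_measure \<Lambda>" and A: "A \<in> sets \<Lambda>"
  shows "prob {\<omega>\<in>space M. N \<omega> \<inter> A = {}} = exp (- measure \<Lambda> A)"
proof -
  interpret \<Lambda>: finite_measure \<Lambda> by fact
  have "emeasure \<Lambda> A < \<infinity>" by (simp add: less_top[symmetric])
  then have "prob {\<omega>\<in>space M. num_points (N \<omega>) A = of_nat 0}
      = exp (- measure \<Lambda> A) * measure \<Lambda> A ^ 0 / fact 0"
    using N A unfolding poisson_process_def by blast
  then show ?thesis by (simp add: num_points_eq_0_iff)
qed

lemma (in prob_space) poisson_process_avoid_half_power: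
  assumes N: "poisson_process M \<Lambda> N" and \<Lambda>: "finite_measure \<Lambda>"
    and A: "A \<in> sets \<Lambda>" and D: "D \<in> sets \<Lambda>" and disj: "A \<inter> D = {}"
  shows "expectation (\<lambda>\<omega>. of_bool (N \<omega> \<inter> A = {}) * half_power (num_points (N \<omega>) D))
    = exp (- measure \<Lambda> A - measure \<Lambda> D / 2)"
proof -
  have Nm: "N \<in> measurable M (config_space \<Lambda>)" using N by (simp add: poisson_process_def)
  have [measurable]: "(\<lambda>\<omega>. num_points (N \<omega>) A) \<in> borel_measurable M"
    "(\<lambda>\<omega>. num_points (N \<omega>) D) \<in> borel_measurable M"
    using measurable_compose[OF Nm measurable_num_points] A D by auto
  \<comment> \<open>Independence of the counts is stated for families indexed by an initial segment of the naturals.\<close>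
  define F where "F i = (if i = 0 then A else D)" for i :: nat
  define Y where "Y i = (if i = 0 then \<lambda>b::ennreal. of_bool (b = 0) else half_power)" for i :: nat
  have "\<forall>i<2. F i \<in> sets \<Lambda>" "disjoint_family_on F {..<2}"
    using A D disj by (auto simp: F_def disjoint_family_on_def)
  then have "indep_vars (\<lambda>_. borel) (\<lambda>i \<omega>. num_points (N \<omega>) (F i)) {..<2}"
    using N unfolding poisson_process_def by blast
  then have "indep_vars (\<lambda>_. borel) (\<lambda>i \<omega>. Y i (num_points (N \<omega>) (F i))) {..<2}"
    by (rule indep_vars_compose2) (auto simp: Y_def)
  moreover have "integrable M (\<lambda>\<omega>. Y i (num_points (N \<omega>) (F i)))" for i
    by (intro integrable_const_bound[where B=1] AE_I2)
       (auto simp: Y_def F_def half_power_bounds)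
  ultimately have "expectation (\<lambda>\<omega>. \<Prod>i<2. Y i (num_points (N \<omega>) (F i)))
      = (\<Prod>i<2. expectation (\<lambda>\<omega>. Y i (num_points (N \<omega>) (F i))))"
    by (intro indep_vars_lebesgue_integral) auto
  then have "expectation (\<lambda>\<omega>. of_bool (N \<omega> \<inter> A = {}) * half_power (num_points (N \<omega>) D))
      = expectation (\<lambda>\<omega>. of_bool (N \<omega> \<inter> A = {})) * expectation (\<lambda>\<omega>. half_power (num_points (N \<omega>) D))"
    by (simp add: numeral_2_eq_2 Y_def F_def num_points_eq_0_iff)
  also have "expectation (\<lambda>\<omega>. of_bool (N \<omega> \<inter> A = {})) = prob {\<omega>\<in>space M. N \<omega> \<inter> A = {}}"
  proof -
    have "{\<omega>\<in>space M. num_points (N \<omega>) A = 0} \<in> events" by measurable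
    then have "prob {\<omega>\<in>space M. N \<omega> \<inter> A = {}} = expectation (indicator {\<omega>\<in>space M. N \<omega> \<inter> A = {}})"
      by (simp add: num_points_eq_0_iff)
    also have "\<dots> = expectation (\<lambda>\<omega>. of_bool (N \<omega> \<inter> A = {}))"
      by (intro Bochner_Integration.integral_cong) (auto simp: indicator_def)
    finally show ?thesis by simp
  qed
  finally show ?thesis
    by (simp add: poisson_process_avoid[OF N \<Lambda> A] poisson_process_half_power[OF N \<Lambda> D] exp_add[symmetric])
qed

text \<open>
  The space \<open>X\<close> is kept apart from the common intensity measure \<open>\<Lambda>\<close>, because configurations and
  conditioning refer to its \<open>\<sigma>\<close>-algebra only.
\<close>

locale poisson_pair = prob_space M for M :: "'w measure" +
  fixes X \<Lambda> :: "'a measure" and N1 Nm1 :: "'w \<Rightarrow> 'a set"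
  assumes sets_\<Lambda> [measurable_cong]: "sets \<Lambda> = sets X"
    and finite_\<Lambda>: "finite_measure \<Lambda>" and non_atomic_\<Lambda>: "non_atomic \<Lambda>"
    and N1: "poisson_process M \<Lambda> N1" and Nm1: "poisson_process M \<Lambda> Nm1"
    and indep: "indep_var (config_space X) N1 (config_space X) Nm1"
begin

sublocale \<Lambda>: finite_measure \<Lambda> by (rule finite_\<Lambda>)

lemma space_\<Lambda>: "space \<Lambda> = space X"
  using sets_\<Lambda> by (rule sets_eq_imp_space_eq)

lemma measurable_N1 [measurable]: "N1 \<in> measurable M (config_space X)"
  and measurable_Nm1 [measurable]: "Nm1 \<in> measurable M (config_space X)"
  using N1 Nm1 by (auto simp: poisson_process_def sets_config_space_cong[OF sets_\<Lambda>])

lemma measurable_counts [measurable]: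
  assumes "A \<in> sets X"
  shows "(\<lambda>\<omega>. num_points (N1 \<omega>) A) \<in> borel_measurable M"
    and "(\<lambda>\<omega>. num_points (Nm1 \<omega>) A) \<in> borel_measurable M"
  using measurable_compose[OF measurable_N1 measurable_num_points[OF assms]]
    measurable_compose[OF measurable_Nm1 measurable_num_points[OF assms]] by auto

lemma prob_count:
  assumes "poisson_process M \<Lambda> N" "A \<in> sets X"
  shows "prob {\<omega>\<in>space M. num_points (N \<omega>) A = of_nat k} = exp (- measure \<Lambda> A) * measure \<Lambda> A ^ k / fact k"
  using assms unfolding poisson_process_def by (auto simp: sets_\<Lambda> less_top[symmetric])

text \<open>
  Two points in \<open>A\<close> means two of the first kind, two of the second, or one of each; each of these
  events has probability at most the square of the expected number of points of one kind.
\<close>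

lemma prob_collision_le:
  assumes A: "A \<in> sets X"
  shows "prob {\<omega>\<in>space M. \<not> num_points (N1 \<omega>) A + num_points (Nm1 \<omega>) A \<le> 1} \<le> 3 * (measure \<Lambda> A)\<^sup>2"
proof -
  define l where "l = measure \<Lambda> A"
  have l: "l \<ge> 0" by (simp add: l_def)
  note [measurable] = measurable_counts[OF A]
  have exp_ge: "exp (- l) \<ge> 1 - l" using exp_ge_add_one_self[of "- l"] by simp
  have ge1: "prob {\<omega>\<in>space M. num_points (N \<omega>) A \<noteq> 0} \<le> l"
    and ge2: "prob {\<omega>\<in>space M. num_points (N \<omega>) A \<noteq> 0 \<and> num_points (N \<omega>) A \<noteq> 1} \<le> l\<^sup>2"
    if N: "poisson_process M \<Lambda> N" and [measurable]: "(\<lambda>\<omega>. num_points (N \<omega>) A) \<in> borel_measurable M" for N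
  proof -
    let ?E = "\<lambda>k::nat. {\<omega>\<in>space M. num_points (N \<omega>) A = of_nat k}"
    have p: "prob (?E 0) = exp (- l)" "prob (?E 1) = exp (- l) * l"
      unfolding prob_count[OF N A] by (simp_all add: l_def)
    have E: "?E 0 \<in> events" "?E 1 \<in> events" by measurable
    have "prob (space M - ?E 0) = 1 - exp (- l)"
      using prob_compl[OF E(1)] p by simp
    moreover have "space M - ?E 0 = {\<omega>\<in>space M. num_points (N \<omega>) A \<noteq> 0}" by auto
    ultimately show "prob {\<omega>\<in>space M. num_points (N \<omega>) A \<noteq> 0} \<le> l" using exp_ge by simp
    have "prob (?E 0 \<union> ?E 1) = exp (- l) + exp (- l) * l"
      using E by (subst finite_measure_Union) (auto simp: p[simplified])
    then have "prob (space M - (?E 0 \<union> ?E 1)) = 1 - exp (- l) * (1 + l)"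
      using prob_compl[of "?E 0 \<union> ?E 1"] E by (simp add: algebra_simps)
    moreover have "space M - (?E 0 \<union> ?E 1)
        = {\<omega>\<in>space M. num_points (N \<omega>) A \<noteq> 0 \<and> num_points (N \<omega>) A \<noteq> 1}" by auto
    moreover have "(1 - l) * (1 + l) \<le> exp (- l) * (1 + l)"
      using exp_ge l by (intro mult_right_mono) auto
    ultimately show "prob {\<omega>\<in>space M. num_points (N \<omega>) A \<noteq> 0 \<and> num_points (N \<omega>) A \<noteq> 1} \<le> l\<^sup>2"
      by (simp add: algebra_simps power2_eq_square)
  qed
  let ?two = "\<lambda>N. {\<omega>\<in>space M. num_points (N \<omega>) A \<noteq> 0 \<and> num_points (N \<omega>) A \<noteq> 1}"
  let ?one = "\<lambda>N. {\<omega>\<in>space M. num_points (N \<omega>) A \<noteq> 0}"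
  have both: "prob (?one N1 \<inter> ?one Nm1) \<le> l\<^sup>2"
  proof -
    have S: "{S \<in> space (config_space X). num_points S A \<noteq> 0} \<in> sets (config_space X)"
      using measurable_num_points[OF A] by measurable
    have v: "N -` {S \<in> space (config_space X). num_points S A \<noteq> 0} \<inter> space M = ?one N"
      if "N \<in> measurable M (config_space X)" for N
      using measurable_space[OF that] by auto
    have "(\<lambda>\<omega>. (N1 \<omega>, Nm1 \<omega>)) -` ({S \<in> space (config_space X). num_points S A \<noteq> 0}
        \<times> {S \<in> space (config_space X). num_points S A \<noteq> 0}) \<inter> space M = ?one N1 \<inter> ?one Nm1"
      using v[OF measurable_N1] v[OF measurable_Nm1] by auto
    then have "prob (?one N1 \<inter> ?one Nm1) = prob (?one N1) * prob (?one Nm1)"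
      using indep_varD[OF indep S S] by (simp only: v[OF measurable_N1] v[OF measurable_Nm1])
    also have "\<dots> \<le> l * l"
      using ge1[OF N1] ge1[OF Nm1] l by (intro mult_mono) auto
    finally show ?thesis by (simp add: power2_eq_square)
  qed
  have "{\<omega>\<in>space M. \<not> num_points (N1 \<omega>) A + num_points (Nm1 \<omega>) A \<le> 1}
      \<subseteq> ?two N1 \<union> ?two Nm1 \<union> (?one N1 \<inter> ?one Nm1)"
    by auto
  then have "prob {\<omega>\<in>space M. \<not> num_points (N1 \<omega>) A + num_points (Nm1 \<omega>) A \<le> 1}
      \<le> prob (?two N1 \<union> ?two Nm1 \<union> (?one N1 \<inter> ?one Nm1))"
    by (intro finite_measure_mono) measurable
  also have "\<dots> \<le> prob (?two N1 \<union> ?two Nm1) + prob (?one N1 \<inter> ?one Nm1)"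
    by (intro measure_Un_le) measurable
  also have "prob (?two N1 \<union> ?two Nm1) \<le> prob (?two N1) + prob (?two Nm1)"
    by (intro measure_Un_le) measurable
  also have "prob (?two N1) \<le> l\<^sup>2" by (rule ge2[OF N1]) measurable
  also have "prob (?two Nm1) \<le> l\<^sup>2" by (rule ge2[OF Nm1]) measurable
  finally show ?thesis using both by (simp add: l_def)
qed

text \<open>
  For a partition into cells of measure at most \<open>e\<close>, some cell contains two points with
  probability at most \<open>\<Sum> 3 (\<Lambda> D)\<^sup>2 \<le> 3 e \<Lambda> X\<close>, which tends to \<open>0\<close> with \<open>e\<close>.
\<close>

lemma ex_separating:
  obtains P where "separating X P"
    "AE \<omega> in M. \<exists>k. \<forall>D\<in>P k. num_points (N1 \<omega>) D + num_points (Nm1 \<omega>) D \<le> 1"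
proof -
  have "\<exists>Q. finite Q \<and> Q \<subseteq> sets X \<and> disjoint Q \<and> \<Union>Q = space X \<and> (\<forall>D\<in>Q. measure \<Lambda> D \<le> 1 / real (Suc k))" for k
    using non_atomic_splits_finely[OF finite_\<Lambda> non_atomic_\<Lambda>, of "1 / real (Suc k)"]
    by (simp add: splits_finely_def sets_\<Lambda> space_\<Lambda>)
  then obtain P where P: "\<And>k. finite (P k)" "\<And>k. P k \<subseteq> sets X" "\<And>k. disjoint (P k)"
    "\<And>k. \<Union>(P k) = space X" "\<And>k D. D \<in> P k \<Longrightarrow> measure \<Lambda> D \<le> 1 / real (Suc k)"
    by metis
  define bad where "bad k = (\<Union>D\<in>P k. {\<omega>\<in>space M. \<not> num_points (N1 \<omega>) D + num_points (Nm1 \<omega>) D \<le> 1})" for k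
  have badD: "{\<omega>\<in>space M. \<not> num_points (N1 \<omega>) D + num_points (Nm1 \<omega>) D \<le> 1} \<in> events" if "D \<in> P k" for D k
  proof -
    have "D \<in> sets X" using P(2) that by auto
    note [measurable] = measurable_counts[OF this]
    show ?thesis by measurable
  qed
  have bad: "bad k \<in> events" for k
    unfolding bad_def using P(1) badD by (intro sets.finite_UN) auto
  have le: "prob (bad k) \<le> 3 * measure \<Lambda> (space X) / real (Suc k)" for k
  proof -
    have "prob (bad k) \<le> (\<Sum>D\<in>P k. prob {\<omega>\<in>space M. \<not> num_points (N1 \<omega>) D + num_points (Nm1 \<omega>) D \<le> 1})"
      unfolding bad_def using P(1) badD by (intro finite_measure_subadditive_finite) auto
    also have "\<dots> \<le> (\<Sum>D\<in>P k. 3 / real (Suc k) * measure \<Lambda> D)"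
    proof (rule sum_mono)
      fix D assume D: "D \<in> P k"
      have "(measure \<Lambda> D)\<^sup>2 \<le> 1 / real (Suc k) * measure \<Lambda> D"
        unfolding power2_eq_square using P(5)[OF D] by (intro mult_right_mono) auto
      then show "prob {\<omega>\<in>space M. \<not> num_points (N1 \<omega>) D + num_points (Nm1 \<omega>) D \<le> 1} \<le> 3 / real (Suc k) * measure \<Lambda> D"
        using prob_collision_le[of D] P(2)[of k] D by fastforce
    qed
    also have "\<dots> = 3 / real (Suc k) * (\<Sum>D\<in>P k. measure \<Lambda> D)" by (simp add: sum_distrib_left)
    also have "(\<Sum>D\<in>P k. measure \<Lambda> D) = measure \<Lambda> (\<Union>D\<in>P k. D)"
      using P(1,2,3)[of k]
      by (intro \<Lambda>.finite_measure_finite_Union[symmetric]) (auto simp: sets_\<Lambda> disjoint_family_on_def disjoint_def)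
    finally show ?thesis using P(4) by (simp add: field_simps)
  qed
  have "prob (\<Inter>k. bad k) \<le> 3 * measure \<Lambda> (space X) / real (Suc k)" for k
    using finite_measure_mono[OF _ bad[of k], of "\<Inter>k. bad k"] le[of k] by fastforce
  moreover have "(\<lambda>k. 3 * measure \<Lambda> (space X) / real (Suc k)) \<longlonglongrightarrow> 0"
    by (rule LIMSEQ_Suc[OF lim_const_over_n])
  ultimately have "prob (\<Inter>k. bad k) \<le> 0"
    by (intro LIMSEQ_le_const[of _ 0]) auto
  then have "(\<Inter>k. bad k) \<in> null_sets M"
    using bad by (intro null_setsI) (auto simp: emeasure_eq_measure measure_le_0_iff)
  then have "AE \<omega> in M. \<omega> \<notin> (\<Inter>k. bad k)" by (rule AE_not_in)
  then have "AE \<omega> in M. \<exists>k. \<forall>D\<in>P k. num_points (N1 \<omega>) D + num_points (Nm1 \<omega>) D \<le> 1"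
    using AE_space by eventually_elim (auto simp: bad_def)
  moreover have "separating X P" using P by (auto simp: separating_def)
  ultimately show ?thesis using that by blast
qed

lemma disjoint_and_separated:
  assumes P: "separating X P" and \<omega>: "\<omega> \<in> space M"
    and k: "\<exists>k. \<forall>D\<in>P k. num_points (N1 \<omega>) D + num_points (Nm1 \<omega>) D \<le> 1"
  shows "N1 \<omega> \<inter> Nm1 \<omega> = {}" and "separated_by P (N1 \<omega> \<union> Nm1 \<omega>)"
proof -
  obtain k where k: "\<And>D. D \<in> P k \<Longrightarrow> num_points (N1 \<omega>) D + num_points (Nm1 \<omega>) D \<le> 1"
    using k by auto
  show disj: "N1 \<omega> \<inter> Nm1 \<omega> = {}"
  proof (rule ccontr)
    assume "N1 \<omega> \<inter> Nm1 \<omega> \<noteq> {}"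
    then obtain x where x: "x \<in> N1 \<omega>" "x \<in> Nm1 \<omega>" by auto
    have "x \<in> space X" using x measurable_space[OF measurable_N1 \<omega>] by (auto simp: space_config_space)
    then obtain D where D: "D \<in> P k" "x \<in> D" using separatingD(4)[OF P, of k] by blast
    then have "N1 \<omega> \<inter> D \<noteq> {}" "Nm1 \<omega> \<inter> D \<noteq> {}" using x by auto
    then have "1 \<le> num_points (N1 \<omega>) D" "1 \<le> num_points (Nm1 \<omega>) D"
      using of_bool_le_num_points[of "N1 \<omega>" D] of_bool_le_num_points[of "Nm1 \<omega>" D] by simp_all
    then have "1 + 1 \<le> num_points (N1 \<omega>) D + num_points (Nm1 \<omega>) D" by (rule add_mono)
    then have "(1 + 1 :: ennreal) \<le> 1" using k[OF D(1)] by (rule order_trans)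
    then show False by simp
  qed
  then show "separated_by P (N1 \<omega> \<union> Nm1 \<omega>)"
    unfolding separated_by_def using k by (intro exI[of _ k]) (auto simp: num_points_Un_disjoint)
qed

end

section \<open>Marked configurations and the sample marks\<close>

text \<open>
  The pooled process and its marks agree with measurable functions of the two samples only where
  these are disjoint, so they are measurable for the completion only.
\<close>

lemma measurable_completionI_AE:
  assumes f: "f \<in> measurable M N" and ae: "AE x in M. f x = g x"
    and g: "\<And>x. x \<in> space M \<Longrightarrow> g x \<in> space N"
  shows "g \<in> measurable (completion M) N"
proof (rule measurableI)
  show "g x \<in> space N" if "x \<in> space (completion M)" for x
    using g that by simp
next
  fix A assume A: "A \<in> sets N"
  show "g -` A \<inter> space (completion M) \<in> sets (completion M)"
  proof (rule completion.in_sets_AE)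
    show "AE x in completion M. (x \<in> f -` A \<inter> space M) = (x \<in> g -` A \<inter> space (completion M))"
      using AE_completion[OF ae] by eventually_elim auto
    show "f -` A \<inter> space M \<in> sets (completion M)"
      using measurable_sets[OF f A] by auto
  qed auto
qed

lemma num_points_marked_points:
  "num_points (marked_points m S) E = num_points S {x. (x, m x) \<in> E}"
proof -
  let ?A = "S \<inter> {x. (x, m x) \<in> E}"
  have im: "marked_points m S \<inter> E = (\<lambda>x. (x, m x)) ` ?A"
    by (auto simp: marked_points_def)
  have inj: "inj_on (\<lambda>x. (x, m x)) ?A" by (auto simp: inj_on_def)
  show ?thesis
    unfolding num_points_cases im using inj by (simp add: finite_image_iff card_image)
qed

lemma num_points_cong: "S \<inter> A = S \<inter> A' \<Longrightarrow> num_points S A = num_points S A'"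
  by (simp add: num_points_def)

lemma fst_image_marked_points: "fst ` marked_points m S = S"
  by (auto simp: marked_points_def image_image)

lemma separating_times_UNIV:
  assumes "separating X P"
  shows "separating (X \<Otimes>\<^sub>M borel) (\<lambda>k. (\<lambda>D. D \<times> UNIV) ` P k)"
  unfolding separating_def
proof (intro allI conjI)
  fix k
  note P = separatingD[OF assms, of k]
  show "finite ((\<lambda>D. D \<times> UNIV) ` P k)" using P by simp
  show "(\<lambda>D. D \<times> UNIV) ` P k \<subseteq> sets (X \<Otimes>\<^sub>M borel)" using P(2) by auto
  show "disjoint ((\<lambda>D. D \<times> UNIV) ` P k)" using P(3) unfolding disjoint_def by blast
  show "\<Union> ((\<lambda>D. D \<times> UNIV) ` P k) = space (X \<Otimes>\<^sub>M borel)"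
    using P(4) by (auto simp: space_pair_measure)
qed

lemma separated_by_marked_points:
  assumes "separated_by P S"
  shows "separated_by (\<lambda>k. (\<lambda>D. D \<times> UNIV) ` P k) (marked_points m S)"
  using assms unfolding separated_by_def by (auto simp: num_points_marked_points)

lemma sets_section_space:
  assumes "E \<in> sets (X \<Otimes>\<^sub>M borel)"
  shows "{x \<in> space X. (x, s::real) \<in> E} \<in> sets X"
proof -
  have "(\<lambda>x. (x, s)) -` E \<inter> space X \<in> sets X"
    using assms by (intro measurable_sets[of _ X "X \<Otimes>\<^sub>M borel"]) auto
  then show ?thesis by (simp add: vimage_def Int_def conj_commute)
qed

lemma measure_rademacher:
  "measure_pmf.prob rademacher U = (of_bool (1 \<in> U) + of_bool (-1 \<in> U)) / 2"
proof -
  have "card ({-1, 1::real} \<inter> U) = of_bool (1 \<in> U) + of_bool (-1 \<in> U)"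
    by (cases "1 \<in> U"; cases "-1 \<in> U") (auto simp: Int_insert_left)
  then show ?thesis
    unfolding rademacher_def by (subst measure_pmf_of_set) auto
qed

lemma measure_rademacher_vec_component:
  assumes "b \<in> {1..B}"
  shows "measure_pmf.prob (rademacher_vec B) {v. v b \<in> U} = measure_pmf.prob rademacher U"
proof -
  have "map_pmf (\<lambda>v. v b) (rademacher_vec B) = rademacher"
    unfolding rademacher_vec_def using assms by (simp add: Pi_pmf_component)
  then have "measure_pmf.prob rademacher U = measure_pmf.prob (map_pmf (\<lambda>v. v b) (rademacher_vec B)) U"
    by simp
  then show ?thesis by (simp add: vimage_def)
qed

text \<open>
  The factor is the probability that a point \<open>x\<close> with a fair sign, marked \<open>1\<close> or \<open>-1\<close>, avoids \<open>A\<close> or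
  \<open>A'\<close>, respectively: it is \<open>0\<close> on \<open>A \<inter> A'\<close>, one half on the symmetric difference and \<open>1\<close> elsewhere.
\<close>

lemma prod_avoid_weight:
  assumes "finite S"
  shows "(\<Prod>x\<in>S. (of_bool (x \<notin> A) + of_bool (x \<notin> A')) / 2)
    = of_bool (S \<inter> (A \<inter> A') = {}) * half_power (num_points S ((A - A') \<union> (A' - A)))"
proof (cases "S \<inter> (A \<inter> A') = {}")
  case True
  let ?D = "(A - A') \<union> (A' - A)"
  have "(\<Prod>x\<in>S. (of_bool (x \<notin> A) + of_bool (x \<notin> A')) / 2) = (\<Prod>x\<in>S. if x \<in> ?D then 1 / 2 else (1::real))"
    using True by (intro prod.cong) auto
  also have "\<dots> = (1 / 2) ^ card (S \<inter> ?D)"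
    unfolding prod.inter_restrict[OF assms, symmetric] by (rule prod_constant)
  finally show ?thesis
    using True assms by (simp add: num_points_finite half_power_of_nat)
next
  case False
  then obtain x where "x \<in> S" "x \<in> A" "x \<in> A'" by auto
  then show ?thesis using assms False by (auto intro!: prod_zero bexI[of _ x])
qed

lemma set_pmf_rademacher_vec: "set_pmf (rademacher_vec B) \<subseteq> space (mark_vec_space B)"
proof
  fix v assume "v \<in> set_pmf (rademacher_vec B)"
  then have "v \<in> {v. \<forall>b. b \<notin> {1..B} \<longrightarrow> v b = undefined}"
    unfolding rademacher_vec_def by (rule subsetD[OF set_Pi_pmf_subset, rotated]) simp
  then show "v \<in> space (mark_vec_space B)"
    by (auto simp: mark_vec_space_def space_PiM PiE_def extensional_def)
qed

lemma prob_Pi_rademacher_vec_avoid: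
  assumes S: "finite S" "S \<subseteq> space X" and b: "b \<in> {1..B}"
  shows "measure_pmf.prob (Pi_pmf S undefined (\<lambda>_. rademacher_vec B))
      {y. marked_points y S \<in> {\<xi> \<in> space (config_space (X \<Otimes>\<^sub>M mark_vec_space B)).
         \<xi> \<inter> {z \<in> space (X \<Otimes>\<^sub>M mark_vec_space B). (fst z, snd z b) \<in> E} = {}}}
    = (\<Prod>x\<in>S. (of_bool ((x, 1) \<notin> E) + of_bool ((x, -1) \<notin> E)) / 2)"
    (is "measure_pmf.prob ?p ?V = _")
proof -
  let ?W = "Pi S (\<lambda>x. {v. v b \<in> {s. (x, s) \<notin> E}})"
  have iff: "y \<in> ?V \<longleftrightarrow> y \<in> ?W" if "y \<in> set_pmf ?p" for y
  proof -
    have y: "y x \<in> space (mark_vec_space B)" if "x \<in> S" for x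
      using set_Pi_pmf_subset'[OF S(1)] set_pmf_rademacher_vec that \<open>y \<in> set_pmf ?p\<close>
      by (fastforce simp: PiE_dflt_def)
    then have "marked_points y S \<in> space (config_space (X \<Otimes>\<^sub>M mark_vec_space B))"
      using S by (auto simp: space_config_space marked_points_def space_pair_measure countable_finite)
    moreover have "marked_points y S \<inter> {z \<in> space (X \<Otimes>\<^sub>M mark_vec_space B). (fst z, snd z b) \<in> E} = {}
        \<longleftrightarrow> (\<forall>x\<in>S. (x, y x b) \<notin> E)"
      using y S(2) by (auto simp: marked_points_def space_pair_measure)
    ultimately show ?thesis by (simp add: Pi_iff)
  qed
  have "measure_pmf.prob ?p ?V = measure_pmf.prob ?p ?W"
  proof (rule measure_prob_cong_0)
    show "pmf ?p y = 0" if "y \<in> ?V - ?W" for y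
      using iff[of y] that unfolding set_pmf_iff by blast
    show "pmf ?p y = 0" if "y \<in> ?W - ?V" for y
      using iff[of y] that unfolding set_pmf_iff by blast
  qed
  also have "measure_pmf.prob ?p ?W = (\<Prod>x\<in>S. measure_pmf.prob (rademacher_vec B) {v. v b \<in> {s. (x, s) \<notin> E}})"
    by (rule measure_Pi_pmf_Pi[OF S(1)])
  also have "\<dots> = (\<Prod>x\<in>S. (of_bool ((x, 1) \<notin> E) + of_bool ((x, -1) \<notin> E)) / 2)"
  proof (intro prod.cong refl)
    fix x
    show "measure_pmf.prob (rademacher_vec B) {v. v b \<in> {s. (x, s) \<notin> E}}
        = (of_bool ((x, 1) \<notin> E) + of_bool ((x, -1) \<notin> E)) / 2"
      unfolding measure_rademacher_vec_component[OF b] measure_rademacher by simp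
  qed
  finally show ?thesis .
qed

lemma subalgebra_generated_by:
  assumes "N \<in> measurable (completion M) (config_space X)"
  shows "subalgebra (completion M) (generated_by M X N)"
proof -
  have "N \<in> space M \<rightarrow> space (config_space X)"
    using measurable_space[OF assms] by auto
  then have "sets (generated_by M X N) = {N -` A \<inter> space M | A. A \<in> sets (config_space X)}"
    unfolding generated_by_def by (rule sets_vimage_algebra2)
  then show ?thesis
    using measurable_sets[OF assms] by (auto simp: subalgebra_def generated_by_def)
qed

text \<open>
  The event is read off the first coordinates of a marked configuration, whatever the marks are. On
  arbitrary sets of pairs the projection need not preserve counts, so the argument restricts to
  graphs of functions.
\<close>

lemma generated_by_marked_points:
  assumes N: "\<And>\<omega>. \<omega> \<in> space M \<Longrightarrow> N \<omega> \<in> space (config_space X)" and A: "A \<in> sets (generated_by M X N)"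
  obtains E where "E \<in> sets (config_space (X \<Otimes>\<^sub>M borel))"
    "\<And>\<omega> m. \<omega> \<in> space M \<Longrightarrow> \<omega> \<in> A \<longleftrightarrow> marked_points (m :: 'a \<Rightarrow> real) (N \<omega>) \<in> E"
proof -
  let ?C = "config_space (X \<Otimes>\<^sub>M (borel :: real measure))"
  define G where "G = {marked_points (m :: 'a \<Rightarrow> real) S | m S. S \<in> space (config_space X)}"
  have mC: "marked_points m S \<in> space ?C" if "S \<in> space (config_space X)" for m S
    using that by (auto simp: space_config_space marked_points_def space_pair_measure)
  have "N \<in> space M \<rightarrow> space (config_space X)" using N by auto
  then obtain D where D: "D \<in> sets (config_space X)" "A = N -` D \<inter> space M"
    using A unfolding generated_by_def by (auto simp: sets_vimage_algebra2)
  have meas: "(\<lambda>\<xi>. fst ` \<xi>) \<in> measurable (restrict_space ?C G) (config_space X)"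
  proof (rule measurable_config_spaceI)
    show "fst ` \<xi> \<in> space (config_space X)" if "\<xi> \<in> space (restrict_space ?C G)" for \<xi>
      using that by (auto simp: space_restrict_space G_def fst_image_marked_points)
  next
    fix A assume A: "A \<in> sets X"
    have "(\<lambda>\<xi>. num_points \<xi> (A \<times> UNIV)) \<in> borel_measurable (restrict_space ?C G)"
      using A by (intro measurable_restrict_space1 measurable_num_points) auto
    then show "(\<lambda>\<xi>. num_points (fst ` \<xi>) A) \<in> borel_measurable (restrict_space ?C G)"
      by (subst measurable_cong[where g="\<lambda>\<xi>. num_points \<xi> (A \<times> UNIV)"])
         (auto simp: space_restrict_space G_def fst_image_marked_points num_points_marked_points)
  qed
  obtain E where E: "E \<in> sets ?C" "(\<lambda>\<xi>. fst ` \<xi>) -` D \<inter> space (restrict_space ?C G) = G \<inter> E"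
    using measurable_sets[OF meas D(1)] unfolding sets_restrict_space by auto
  show ?thesis
  proof (rule that[OF E(1)])
    fix \<omega> and m :: "'a \<Rightarrow> real" assume \<omega>: "\<omega> \<in> space M"
    have G: "marked_points m (N \<omega>) \<in> G" "marked_points m (N \<omega>) \<in> space ?C"
      using N[OF \<omega>] mC by (auto simp: G_def)
    have "\<omega> \<in> A \<longleftrightarrow> fst ` marked_points m (N \<omega>) \<in> D"
      using D(2) \<omega> by (simp add: fst_image_marked_points)
    also have "\<dots> \<longleftrightarrow> marked_points m (N \<omega>) \<in> (\<lambda>\<xi>. fst ` \<xi>) -` D \<inter> space (restrict_space ?C G)"
      using G by (simp add: space_restrict_space)
    finally show "\<omega> \<in> A \<longleftrightarrow> marked_points m (N \<omega>) \<in> E"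
      using G unfolding E(2) by simp
  qed
qed

context poisson_pair
begin

abbreviation "pool \<equiv> pooled N1 Nm1"

sublocale C: prob_space "completion M" by (rule prob_space_completion)

lemma pool_in_space: "\<omega> \<in> space M \<Longrightarrow> pool \<omega> \<in> space (config_space X)"
  using measurable_space[OF measurable_N1] measurable_space[OF measurable_Nm1]
  by (auto simp: pooled_def space_config_space)

lemma AE_disjoint: "AE \<omega> in M. N1 \<omega> \<inter> Nm1 \<omega> = {}"
proof -
  obtain P where P: "separating X P"
    "AE \<omega> in M. \<exists>k. \<forall>D\<in>P k. num_points (N1 \<omega>) D + num_points (Nm1 \<omega>) D \<le> 1"
    by (rule ex_separating)
  show ?thesis using P(2) AE_space by eventually_elim (rule disjoint_and_separated(1)[OF P(1)])
qed

lemma AE_separated: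
  obtains P where "separating X P" "AE \<omega> in M. separated_by P (pool \<omega>)"
proof -
  obtain P where P: "separating X P"
    "AE \<omega> in M. \<exists>k. \<forall>D\<in>P k. num_points (N1 \<omega>) D + num_points (Nm1 \<omega>) D \<le> 1"
    by (rule ex_separating)
  have "AE \<omega> in M. separated_by P (pool \<omega>)"
    using P(2) AE_space
    by eventually_elim (simp add: pooled_def disjoint_and_separated(2)[OF P(1)])
  then show ?thesis using P(1) that by blast
qed

lemma AE_finite: "AE \<omega> in M. finite (pool \<omega>)"
proof -
  obtain P where P: "separating X P" "AE \<omega> in M. separated_by P (pool \<omega>)"
    by (rule AE_separated)
  show ?thesis
    using P(2) AE_space
  proof eventually_elim
    case (elim \<omega>)
    then show ?case
      using separated_by_finite[OF P(1)] pool_in_space by (auto simp: space_config_space)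
  qed
qed

lemma measurable_pool: "pool \<in> measurable (completion M) (config_space X)"
proof (rule measurable_config_spaceI)
  fix A assume A: "A \<in> sets X"
  show "(\<lambda>\<omega>. num_points (pool \<omega>) A) \<in> borel_measurable (completion M)"
  proof (rule measurable_completionI_AE)
    show "(\<lambda>\<omega>. num_points (N1 \<omega>) A + num_points (Nm1 \<omega>) A) \<in> borel_measurable M"
      using measurable_counts[OF A] by measurable
    show "AE \<omega> in M. num_points (N1 \<omega>) A + num_points (Nm1 \<omega>) A = num_points (pool \<omega>) A"
      using AE_disjoint
      by eventually_elim (auto simp: pooled_def intro!: num_points_Un_disjoint[symmetric])
  qed simp
qed (simp add: pool_in_space)

sublocale cond: finite_measure_subalgebra "completion M" "generated_by M X pool"
  by unfold_locales (rule subalgebra_generated_by[OF measurable_pool])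

lemma num_points_sample_marks:
  assumes \<omega>: "\<omega> \<in> space M" and disj: "N1 \<omega> \<inter> Nm1 \<omega> = {}"
  shows "num_points (marked_points (sample_mark N1 \<omega>) (pool \<omega>)) E
    = num_points (N1 \<omega>) {x \<in> space X. (x, 1) \<in> E} + num_points (Nm1 \<omega>) {x \<in> space X. (x, -1) \<in> E}"
proof -
  have sub: "N1 \<omega> \<subseteq> space X" "Nm1 \<omega> \<subseteq> space X"
    using measurable_space[OF measurable_N1 \<omega>] measurable_space[OF measurable_Nm1 \<omega>]
    by (auto simp: space_config_space)
  let ?A = "{x. (x, sample_mark N1 \<omega> x) \<in> E}"
  have "num_points (pool \<omega>) ?A = num_points (N1 \<omega>) ?A + num_points (Nm1 \<omega>) ?A"
    unfolding pooled_def using disj by (intro num_points_Un_disjoint) auto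
  also have "num_points (N1 \<omega>) ?A = num_points (N1 \<omega>) {x \<in> space X. (x, 1) \<in> E}"
    using sub by (intro num_points_cong) (auto simp: sample_mark_def)
  also have "num_points (Nm1 \<omega>) ?A = num_points (Nm1 \<omega>) {x \<in> space X. (x, -1) \<in> E}"
    using sub disj by (intro num_points_cong) (auto simp: sample_mark_def)
  finally show ?thesis by (simp add: num_points_marked_points)
qed

lemma marked_pool_in_space:
  "\<omega> \<in> space M \<Longrightarrow> marked_points (m :: 'a \<Rightarrow> real) (pool \<omega>) \<in> space (config_space (X \<Otimes>\<^sub>M borel))"
  using pool_in_space[of \<omega>] by (auto simp: space_config_space marked_points_def space_pair_measure)

lemma measurable_sample_marks:
  "(\<lambda>\<omega>. marked_points (sample_mark N1 \<omega>) (pool \<omega>))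
    \<in> measurable (completion M) (config_space (X \<Otimes>\<^sub>M borel))"
proof (rule measurable_config_spaceI)
  fix E :: "('a \<times> real) set" assume E: "E \<in> sets (X \<Otimes>\<^sub>M borel)"
  let ?A = "\<lambda>s. {x \<in> space X. (x, s) \<in> E}"
  show "(\<lambda>\<omega>. num_points (marked_points (sample_mark N1 \<omega>) (pool \<omega>)) E) \<in> borel_measurable (completion M)"
  proof (rule measurable_completionI_AE)
    show "(\<lambda>\<omega>. num_points (N1 \<omega>) (?A 1) + num_points (Nm1 \<omega>) (?A (-1))) \<in> borel_measurable M"
      using measurable_counts[OF sets_section_space[OF E]] by measurable
    show "AE \<omega> in M. num_points (N1 \<omega>) (?A 1) + num_points (Nm1 \<omega>) (?A (-1))
        = num_points (marked_points (sample_mark N1 \<omega>) (pool \<omega>)) E"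
      using AE_disjoint AE_space by eventually_elim (rule num_points_sample_marks[symmetric])
  qed simp
qed (simp add: marked_pool_in_space)

lemma prob_sample_marks_avoid:
  assumes E: "E \<in> sets (X \<Otimes>\<^sub>M borel)"
  shows "measure (completion M) {\<omega>\<in>space M. marked_points (sample_mark N1 \<omega>) (pool \<omega>) \<inter> E = {}}
    = exp (- measure \<Lambda> {x \<in> space X. (x, 1) \<in> E} - measure \<Lambda> {x \<in> space X. (x, -1) \<in> E})"
proof -
  let ?A = "\<lambda>s. {x \<in> space X. (x, s) \<in> E}"
  have A: "?A s \<in> sets X" for s by (rule sets_section_space[OF E])
  let ?R = "{\<omega>\<in>space M. N1 \<omega> \<inter> ?A 1 = {} \<and> Nm1 \<omega> \<inter> ?A (-1) = {}}"
  let ?Q = "{\<omega>\<in>space M. marked_points (sample_mark N1 \<omega>) (pool \<omega>) \<inter> E = {}}"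
  have "{\<omega>\<in>space M. num_points (N1 \<omega>) (?A 1) = 0 \<and> num_points (Nm1 \<omega>) (?A (-1)) = 0} \<in> events"
    using measurable_counts[OF A] by measurable
  then have R: "?R \<in> events" by (simp add: num_points_eq_0_iff)
  have "{\<omega>\<in>space (completion M). num_points (marked_points (sample_mark N1 \<omega>) (pool \<omega>)) E = 0}
      \<in> sets (completion M)"
    using measurable_compose[OF measurable_sample_marks measurable_num_points[OF E]] by measurable
  then have Q: "?Q \<in> sets (completion M)" by (simp add: num_points_eq_0_iff)
  have eq: "marked_points (sample_mark N1 \<omega>) (pool \<omega>) \<inter> E = {} \<longleftrightarrow> N1 \<omega> \<inter> ?A 1 = {} \<and> Nm1 \<omega> \<inter> ?A (-1) = {}"
    if "\<omega> \<in> space M" "N1 \<omega> \<inter> Nm1 \<omega> = {}" for \<omega>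
  proof -
    have "num_points (marked_points (sample_mark N1 \<omega>) (pool \<omega>)) E = 0
        \<longleftrightarrow> num_points (N1 \<omega>) (?A 1) = 0 \<and> num_points (Nm1 \<omega>) (?A (-1)) = 0"
      unfolding num_points_sample_marks[OF that] by simp
    then show ?thesis unfolding num_points_eq_0_iff .
  qed
  have "AE \<omega> in M. \<omega> \<in> ?Q \<longleftrightarrow> \<omega> \<in> ?R"
    using AE_disjoint
  proof (rule AE_mp, intro AE_I2 impI)
    fix \<omega> assume \<omega>: "\<omega> \<in> space M" "N1 \<omega> \<inter> Nm1 \<omega> = {}"
    show "\<omega> \<in> ?Q \<longleftrightarrow> \<omega> \<in> ?R" using eq[OF \<omega>] \<omega>(1) by blast
  qed
  then have "AE \<omega> in completion M. \<omega> \<in> ?Q \<longleftrightarrow> \<omega> \<in> ?R"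
    by (rule AE_completion)
  then have "measure (completion M) ?Q = measure (completion M) ?R"
    using Q R by (intro C.finite_measure_eq_AE) auto
  also have "\<dots> = prob ?R" using R by simp
  also have "\<dots> = prob {\<omega>\<in>space M. N1 \<omega> \<inter> ?A 1 = {}} * prob {\<omega>\<in>space M. Nm1 \<omega> \<inter> ?A (-1) = {}}"
  proof -
    have S: "{S \<in> space (config_space X). S \<inter> ?A s = {}} \<in> sets (config_space X)" for s
    proof -
      have "{S \<in> space (config_space X). num_points S (?A s) = 0} \<in> sets (config_space X)"
        using measurable_num_points[OF A] by measurable
      then show ?thesis by (simp add: num_points_eq_0_iff)
    qed
    have v: "N -` {S \<in> space (config_space X). S \<inter> ?A s = {}} \<inter> space M = {\<omega>\<in>space M. N \<omega> \<inter> ?A s = {}}"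
      if "N \<in> measurable M (config_space X)" for N s
      using measurable_space[OF that] by auto
    have "(\<lambda>\<omega>. (N1 \<omega>, Nm1 \<omega>)) -` ({S \<in> space (config_space X). S \<inter> ?A 1 = {}}
        \<times> {S \<in> space (config_space X). S \<inter> ?A (-1) = {}}) \<inter> space M = ?R"
      using measurable_space[OF measurable_N1] measurable_space[OF measurable_Nm1] by auto
    then show ?thesis
      using indep_varD[OF indep S S, of 1 "-1"] by (simp only: v[OF measurable_N1] v[OF measurable_Nm1])
  qed
  also have "\<dots> = exp (- measure \<Lambda> (?A 1)) * exp (- measure \<Lambda> (?A (-1)))"
    using poisson_process_avoid[OF N1 finite_\<Lambda>] poisson_process_avoid[OF Nm1 finite_\<Lambda>] A
    by (simp add: sets_\<Lambda>)
  finally show ?thesis by (simp add: exp_add[symmetric])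
qed

text \<open>
  On \<open>A \<inter> A'\<close> both samples must have no point, and each point in the symmetric difference costs a factor
  one half. The two samples contribute \<open>exp (- \<Lambda> (A \<inter> A') - \<Lambda> (A \<triangle> A') / 2)\<close> each, and
  \<open>2 \<Lambda> (A \<inter> A') + \<Lambda> (A \<triangle> A') = \<Lambda> A + \<Lambda> A'\<close>.
\<close>

lemma expectation_avoid_weight:
  assumes A: "A \<in> sets X" "A' \<in> sets X"
  defines "w \<equiv> \<lambda>S. of_bool (S \<inter> (A \<inter> A') = {}) * half_power (num_points S ((A - A') \<union> (A' - A)))"
  shows "expectation (\<lambda>\<omega>. w (N1 \<omega>) * w (Nm1 \<omega>)) = exp (- measure \<Lambda> A - measure \<Lambda> A')"
    and "(\<lambda>\<omega>. w (N1 \<omega>) * w (Nm1 \<omega>)) \<in> borel_measurable M"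
proof -
  let ?I = "A \<inter> A'" and ?D = "(A - A') \<union> (A' - A)"
  have sets: "?I \<in> sets X" "?D \<in> sets X" using A by auto
  have "(\<lambda>S. of_bool (num_points S ?I = 0) * half_power (num_points S ?D)) \<in> borel_measurable (config_space X)"
    using measurable_num_points[OF sets(1)] measurable_num_points[OF sets(2)] by measurable
  then have w [measurable]: "w \<in> borel_measurable (config_space X)"
    by (simp add: w_def num_points_eq_0_iff)
  show "(\<lambda>\<omega>. w (N1 \<omega>) * w (Nm1 \<omega>)) \<in> borel_measurable M" by measurable
  have "indep_var borel (w \<circ> N1) borel (w \<circ> Nm1)"
    by (rule indep_var_compose[OF indep w w])
  moreover have "integrable M (\<lambda>\<omega>. w (N \<omega>))" if [measurable]: "N \<in> measurable M (config_space X)" for N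
  proof (intro integrable_const_bound[where B=1] AE_I2)
    show "norm (w (N \<omega>)) \<le> 1" for \<omega> by (simp add: w_def half_power_bounds)
    show "(\<lambda>\<omega>. w (N \<omega>)) \<in> borel_measurable M" by measurable
  qed
  ultimately have "expectation (\<lambda>\<omega>. w (N1 \<omega>) * w (Nm1 \<omega>)) = expectation (\<lambda>\<omega>. w (N1 \<omega>)) * expectation (\<lambda>\<omega>. w (Nm1 \<omega>))"
    using indep_var_lebesgue_integral[of "w \<circ> N1" "w \<circ> Nm1"] by (simp add: comp_def)
  also have "expectation (\<lambda>\<omega>. w (N1 \<omega>)) = exp (- measure \<Lambda> ?I - measure \<Lambda> ?D / 2)"
    unfolding w_def using sets by (intro poisson_process_avoid_half_power[OF N1 finite_\<Lambda>]) (auto simp: sets_\<Lambda>)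
  also have "expectation (\<lambda>\<omega>. w (Nm1 \<omega>)) = exp (- measure \<Lambda> ?I - measure \<Lambda> ?D / 2)"
    unfolding w_def using sets by (intro poisson_process_avoid_half_power[OF Nm1 finite_\<Lambda>]) (auto simp: sets_\<Lambda>)
  also have "exp (- measure \<Lambda> ?I - measure \<Lambda> ?D / 2) * exp (- measure \<Lambda> ?I - measure \<Lambda> ?D / 2)
      = exp (- (2 * measure \<Lambda> ?I + measure \<Lambda> ?D))"
    by (simp add: exp_add[symmetric])
  also have "2 * measure \<Lambda> ?I + measure \<Lambda> ?D = measure \<Lambda> A + measure \<Lambda> A'"
  proof -
    have "measure \<Lambda> ?D = measure \<Lambda> (A - A') + measure \<Lambda> (A' - A)"
      using A by (intro \<Lambda>.finite_measure_Union) (auto simp: sets_\<Lambda>)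
    moreover have "measure \<Lambda> A = measure \<Lambda> (?I \<union> (A - A'))" "measure \<Lambda> A' = measure \<Lambda> (?I \<union> (A' - A))"
      by (auto intro!: arg_cong[where f="measure \<Lambda>"])
    moreover have "measure \<Lambda> (?I \<union> (A - A')) = measure \<Lambda> ?I + measure \<Lambda> (A - A')"
      "measure \<Lambda> (?I \<union> (A' - A)) = measure \<Lambda> ?I + measure \<Lambda> (A' - A)"
      using A by (auto intro!: \<Lambda>.finite_measure_Union simp: sets_\<Lambda>)
    ultimately show ?thesis by simp
  qed
  finally show "expectation (\<lambda>\<omega>. w (N1 \<omega>) * w (Nm1 \<omega>)) = exp (- measure \<Lambda> A - measure \<Lambda> A')" by simp
qed

end

section \<open>Ranks, quantiles and independent signs\<close>

lemma sum_of_bool_card: "finite A \<Longrightarrow> (\<Sum>x\<in>A. of_bool (P x)) = real (card {x\<in>A. P x})"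
  by (simp add: sum_of_bool_eq Collect_conj_eq)

text \<open>
  Let \<open>i\<close> have the smallest value among the indices with at least \<open>m\<close> smaller values. The indices
  with values below that of \<open>i\<close>, at least \<open>m\<close> many, are not among them.
\<close>

lemma card_many_smaller_le:
  fixes v :: "nat \<Rightarrow> real"
  assumes I: "finite I" and m: "m \<le> card I"
  shows "card {i\<in>I. m \<le> card {j\<in>I. v j < v i}} + m \<le> card I"
proof (cases "{i\<in>I. m \<le> card {j\<in>I. v j < v i}} = {}")
  case True
  show ?thesis unfolding True using m by simp
next
  case False
  let ?R = "{i\<in>I. m \<le> card {j\<in>I. v j < v i}}"
  have "finite ?R" using I by simp
  define i where "i = arg_min_on v ?R"
  have i: "i \<in> ?R" "\<And>j. j \<in> ?R \<Longrightarrow> v i \<le> v j"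
    using arg_min_if_finite[OF \<open>finite ?R\<close> False, of v] unfolding i_def[symmetric]
    by (simp, meson linorder_not_le)
  let ?L = "{j\<in>I. v j < v i}"
  have "card ?R + card ?L = card (?R \<union> ?L)"
    using I i(2) by (intro card_Un_disjoint[symmetric]) (auto simp: not_less[symmetric])
  also have "\<dots> \<le> card I" using I by (intro card_mono) auto
  finally show ?thesis using i(1) by simp
qed

text \<open>
  The quantile is the \<open>m\<close>-th smallest resampled statistic, as the distribution function reaches
  \<open>1 - \<alpha>\<close> where at least \<open>m = B - \<lfloor>B \<alpha>\<rfloor>\<close> of these are counted. As \<open>m\<close> is positive, the infimum is
  taken over a set that is bounded below.
\<close>

lemma mc_quantile_less_iff:
  fixes t :: real
  assumes B: "B \<ge> 1" and \<alpha>: "0 < \<alpha>" "\<alpha> < 1"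
  defines "m \<equiv> B - nat \<lfloor>real B * \<alpha>\<rfloor>"
  shows "mc_quantile K B \<alpha> S e < t \<longleftrightarrow> m \<le> card {b\<in>{1..B}. T_stat K S (e b) < t}"
    and "int m = int B - \<lfloor>real B * \<alpha>\<rfloor>" and "1 \<le> m" and "m \<le> B"
proof -
  let ?T = "\<lambda>b. T_stat K S (e b)"
  have fl: "0 \<le> \<lfloor>real B * \<alpha>\<rfloor>" using \<alpha> by simp
  have "real B * \<alpha> < real B" using B \<alpha> by simp
  then have fl2: "\<lfloor>real B * \<alpha>\<rfloor> < int B" by (simp add: floor_less_iff)
  show int_m: "int m = int B - \<lfloor>real B * \<alpha>\<rfloor>"
    unfolding m_def using fl fl2 by linarith
  show m1: "1 \<le> m" and "m \<le> B" using int_m fl fl2 by linarith+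
  have cdf: "1 - \<alpha> \<le> mc_cdf K B S e s \<longleftrightarrow> m \<le> card {b\<in>{1..B}. ?T b \<le> s}" for s
  proof -
    let ?c = "card {b\<in>{1..B}. ?T b \<le> s}"
    have "(\<Sum>b = 1..B. of_bool (?T b \<le> s)) = real ?c"
      by (rule sum_of_bool_card) simp
    then have "1 - \<alpha> \<le> mc_cdf K B S e s \<longleftrightarrow> real B - real ?c \<le> real B * \<alpha>"
      unfolding mc_cdf_def using B by (simp add: field_simps)
    also have "\<dots> \<longleftrightarrow> of_int (int B - int ?c) \<le> real B * \<alpha>" by simp
    also have "\<dots> \<longleftrightarrow> int B - int ?c \<le> \<lfloor>real B * \<alpha>\<rfloor>" by (rule le_floor_iff[symmetric])
    also have "\<dots> \<longleftrightarrow> m \<le> ?c" using int_m by linarith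
    finally show ?thesis .
  qed
  let ?V = "{s. m \<le> card {b\<in>{1..B}. ?T b \<le> s}}"
  have q: "mc_quantile K B \<alpha> S e = Inf ?V"
    unfolding mc_quantile_def cdf ..
  have "{b\<in>{1..B}. ?T b \<le> Max (?T ` {1..B})} = {1..B}" by auto
  then have ne: "Max (?T ` {1..B}) \<in> ?V" using \<open>m \<le> B\<close> by simp
  have bdd: "bdd_below ?V"
  proof (rule bdd_belowI)
    fix s assume "s \<in> ?V"
    then have "card {b\<in>{1..B}. ?T b \<le> s} > 0" using m1 by simp
    then obtain b where "b \<in> {1..B}" "?T b \<le> s" by (auto simp: card_gt_0_iff)
    then show "Min (?T ` {1..B}) \<le> s" by (intro Min.coboundedI[THEN order_trans]) auto
  qed
  have "Inf ?V < t \<longleftrightarrow> (\<exists>s\<in>?V. s < t)"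
    using ne bdd by (intro cInf_less_iff) auto
  also have "\<dots> \<longleftrightarrow> m \<le> card {b\<in>{1..B}. ?T b < t}"
  proof
    assume "\<exists>s\<in>?V. s < t"
    then obtain s where s: "m \<le> card {b\<in>{1..B}. ?T b \<le> s}" "s < t" by auto
    have "card {b\<in>{1..B}. ?T b \<le> s} \<le> card {b\<in>{1..B}. ?T b < t}"
      using s(2) by (intro card_mono) auto
    then show "m \<le> card {b\<in>{1..B}. ?T b < t}" using s(1) by simp
  next
    assume m: "m \<le> card {b\<in>{1..B}. ?T b < t}"
    let ?L = "{b\<in>{1..B}. ?T b < t}"
    have "?L \<noteq> {}"
    proof
      assume "?L = {}"
      then have "card ?L = 0" by (simp only: card.empty)
      then show False using m m1 by linarith
    qed
    then have "Max (?T ` ?L) \<in> ?T ` ?L" by (intro Max_in) auto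
    then have "Max (?T ` ?L) < t" by auto
    moreover have "?L = {b\<in>{1..B}. ?T b \<le> Max (?T ` ?L)}"
      using \<open>Max (?T ` ?L) < t\<close> by auto
    then have "Max (?T ` ?L) \<in> ?V" using m by simp
    ultimately show "\<exists>s\<in>?V. s < t" by blast
  qed
  finally show "mc_quantile K B \<alpha> S e < t \<longleftrightarrow> m \<le> card {b\<in>{1..B}. ?T b < t}"
    using q by simp
qed

text \<open>
  Both sides are uniform on the arrays indexed by \<open>S \<times> I\<close>, stored by rows or by columns.
\<close>

lemma Pi_pmf_of_set_transpose:
  assumes S: "finite S" and I: "finite I" and A: "finite A" "A \<noteq> {}"
  shows "map_pmf (\<lambda>y b. if b \<in> I then (\<lambda>x. if x \<in> S then y x b else d1) else d2)
      (Pi_pmf S d3 (\<lambda>_. Pi_pmf I d4 (\<lambda>_. pmf_of_set A)))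
    = Pi_pmf I d2 (\<lambda>_. Pi_pmf S d1 (\<lambda>_. pmf_of_set A))"
proof -
  let ?F = "\<lambda>y b. if b \<in> I then (\<lambda>x. if x \<in> S then y x b else d1) else d2"
  let ?G = "\<lambda>z x. if x \<in> S then (\<lambda>b. if b \<in> I then z b x else d4) else d3"
  let ?D = "PiE_dflt S d3 (\<lambda>_. PiE_dflt I d4 (\<lambda>_. A))" and ?E = "PiE_dflt I d2 (\<lambda>_. PiE_dflt S d1 (\<lambda>_. A))"
  have fin: "finite (PiE_dflt S d1 (\<lambda>_. A))" "finite (PiE_dflt I d4 (\<lambda>_. A))"
    using S I A by auto
  have ne: "PiE_dflt S d1 (\<lambda>_. A) \<noteq> {}" "PiE_dflt I d4 (\<lambda>_. A) \<noteq> {}" using A by auto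
  have D: "finite ?D" "?D \<noteq> {}" using fin ne S by auto
  have bij: "bij_betw ?F ?D ?E"
  proof (rule bij_betwI[where g="?G"])
    show "?F \<in> ?D \<rightarrow> ?E" "?G \<in> ?E \<rightarrow> ?D" by (auto simp: PiE_dflt_def)
    show "?G (?F y) = y" if "y \<in> ?D" for y
    proof (intro ext)
      fix x b show "?G (?F y) x b = y x b"
        using that by (cases "x \<in> S"; cases "b \<in> I") (simp_all add: PiE_dflt_def)
    qed
    show "?F (?G z) = z" if "z \<in> ?E" for z
    proof (intro ext)
      fix b x show "?F (?G z) b x = z b x"
        using that by (cases "x \<in> S"; cases "b \<in> I") (simp_all add: PiE_dflt_def)
    qed
  qed
  have "map_pmf ?F (pmf_of_set ?D) = pmf_of_set ?E"
    using bij D by (intro map_pmf_of_set_bij_betw) auto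
  then show ?thesis
    using S I A fin ne by (simp add: Pi_pmf_of_set)
qed

text \<open>
  Assigning a sign vector to each point is the same as choosing \<open>B\<close> independent sign sequences.
  The events are required to depend on the values at points of \<open>S\<close> only, since values elsewhere are
  defaults.
\<close>

lemma prob_rademacher_vec_factor:
  assumes S: "finite S"
    and G: "\<And>b e e'. (\<And>x. x \<in> S \<Longrightarrow> e x = e' x) \<Longrightarrow> e \<in> G b \<longleftrightarrow> e' \<in> G b"
  shows "measure_pmf.prob (Pi_pmf S d (\<lambda>_. rademacher_vec B)) {y. \<forall>b\<in>{1..B}. (\<lambda>x. y x b) \<in> G b}
    = (\<Prod>b\<in>{1..B}. measure_pmf.prob (Pi_pmf S 0 (\<lambda>_. rademacher)) (G b))"
proof -
  let ?F = "\<lambda>y b. if b \<in> {1..B} then (\<lambda>x. if x \<in> S then y x b else 0) else undefined"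
  have map: "map_pmf ?F (Pi_pmf S d (\<lambda>_. rademacher_vec B))
      = Pi_pmf {1..B} undefined (\<lambda>_. Pi_pmf S 0 (\<lambda>_. rademacher))"
    unfolding rademacher_vec_def rademacher_def
    using S by (intro Pi_pmf_of_set_transpose) auto
  have "measure_pmf.prob (Pi_pmf {1..B} undefined (\<lambda>_. Pi_pmf S 0 (\<lambda>_. rademacher))) (Pi {1..B} G)
      = measure_pmf.prob (Pi_pmf S d (\<lambda>_. rademacher_vec B)) (?F -` Pi {1..B} G)"
    unfolding map[symmetric] by (rule measure_map_pmf)
  also have "?F -` Pi {1..B} G = {y. \<forall>b\<in>{1..B}. (\<lambda>x. y x b) \<in> G b}"
  proof -
    have "(\<lambda>x. if x \<in> S then y x b else 0) \<in> G b \<longleftrightarrow> (\<lambda>x. y x b) \<in> G b" for y b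
      by (rule G) simp
    then show ?thesis by (auto simp: Pi_iff)
  qed
  finally show ?thesis by (simp add: measure_Pi_pmf_Pi)
qed

lemma T_stat_cong: "(\<And>x. x \<in> S \<Longrightarrow> e x = e' x) \<Longrightarrow> T_stat K S e = T_stat K S e'"
  unfolding T_stat_def by (intro sum.cong) auto

lemma measure_Int_eq_cond_exp:
  assumes "finite_measure_subalgebra M F" "R \<in> sets M" "A \<in> sets F"
  shows "measure M (A \<inter> R) = (\<integral>x\<in>A. real_cond_exp M F (indicator R) x \<partial>M)"
proof -
  interpret finite_measure_subalgebra M F by fact
  have A: "A \<in> sets M" using assms(3) subalg by (auto simp: subalgebra_def)
  have "(\<integral>x\<in>A. real_cond_exp M F (indicator R) x \<partial>M) = (\<integral>x\<in>A. indicator R x \<partial>M)"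
    using assms(2,3) by (intro real_cond_exp_intA[symmetric]) (auto simp: integrable_indicator_iff less_top[symmetric])
  also have "\<dots> = (\<integral>x. indicator (A \<inter> R) x \<partial>M)"
    unfolding set_lebesgue_integral_def
    by (intro Bochner_Integration.integral_cong) (auto simp: indicator_def)
  also have "\<dots> = measure M (A \<inter> R)" using A assms(2) sets.sets_into_space by (auto simp: Int_absorb2)
  finally show ?thesis by simp
qed

lemma cond_exp_indicator_cong:
  assumes fin: "finite_measure_subalgebra M F" and R: "R \<in> sets M" "R' \<in> sets M"
    and eq: "\<And>A. A \<in> sets F \<Longrightarrow> measure M (A \<inter> R) = measure M (A \<inter> R')"
  shows "AE x in M. real_cond_exp M F (indicator R) x = real_cond_exp M F (indicator R') x"
proof -
  interpret finite_measure_subalgebra M F by fact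
  have int: "integrable M (indicator Z :: _ \<Rightarrow> real)" if "Z \<in> sets M" for Z
    using that by (auto simp: integrable_indicator_iff less_top[symmetric])
  show ?thesis
  proof (rule real_cond_exp_charact)
    fix A assume A: "A \<in> sets F"
    have "A \<in> sets M" using A subalg by (auto simp: subalgebra_def)
    then have "(\<integral>x\<in>A. indicator R x \<partial>M) = measure M (A \<inter> R)"
      using measure_Int_eq_cond_exp[OF fin R(1) A] real_cond_exp_intA[OF int[OF R(1)] A] by simp
    then show "(\<integral>x\<in>A. indicator R x \<partial>M) = (\<integral>x\<in>A. real_cond_exp M F (indicator R') x \<partial>M)"
      using measure_Int_eq_cond_exp[OF fin R(2) A] eq[OF A] by simp
  qed (use int R real_cond_exp_int(1) in auto)
qed

section \<open>Exchangeable statistics\<close>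

text \<open>
  The conditional probabilities of boxes are symmetric in the coordinates, so on each event of \<open>F\<close>
  the vector of statistics has a permutation-invariant law. Hence all \<open>B + 1\<close> statistics have the same
  conditional probability of exceeding at least \<open>m\<close> others, and \<open>card_many_smaller_le\<close> bounds the sum
  of these probabilities.
\<close>

lemma exchangeable_rank_bound:
  fixes T :: "nat \<Rightarrow> 'w \<Rightarrow> real" and q :: "real set \<Rightarrow> 'w \<Rightarrow> real"
  assumes fin: "finite_measure_subalgebra M F"
    and T: "\<And>i. i \<le> B \<Longrightarrow> T i \<in> borel_measurable M"
    and box: "\<And>U. (\<And>i. U i \<in> sets borel) \<Longrightarrow> AE \<omega> in M.
      real_cond_exp M F (indicator {\<omega>\<in>space M. \<forall>i\<le>B. T i \<omega> \<in> U i}) \<omega> = (\<Prod>i\<le>B. q (U i) \<omega>)"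
    and m: "m \<le> B"
  shows "AE \<omega> in M. real_cond_exp M F
      (indicator {\<omega>\<in>space M. m \<le> card {j\<in>{..B}. T j \<omega> < T 0 \<omega>}}) \<omega>
    \<le> (real B + 1 - real m) / (real B + 1)"
proof -
  interpret finite_measure_subalgebra M F by fact
  let ?P = "Pi\<^sub>M {..B} (\<lambda>_. borel :: real measure)"
  have boxM: "{\<omega>\<in>space M. \<forall>i\<le>B. T i \<omega> \<in> U i} \<in> sets M" if "\<And>i. U i \<in> sets borel" for U
  proof -
    have "(\<Inter>i\<in>{..B}. T i -` U i \<inter> space M) \<in> sets M"
      using T that by (intro sets.finite_INT measurable_sets[of "T _" M borel]) auto
    moreover have "(\<Inter>i\<in>{..B}. T i -` U i \<inter> space M) = {\<omega>\<in>space M. \<forall>i\<le>B. T i \<omega> \<in> U i}" by auto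
    ultimately show ?thesis by (simp only:)
  qed
  define R where "R i = {v \<in> space ?P. real m \<le> (\<Sum>j\<le>B. of_bool (v j < v i))}" for i :: nat
  have Rs: "R i \<in> sets ?P" if "i \<le> B" for i
  proof -
    have comp: "(\<lambda>v. v j) \<in> borel_measurable ?P" if "j \<le> B" for j
      using that by (intro measurable_component_singleton) auto
    have "(\<lambda>v. of_bool (v j < v i) :: real) \<in> borel_measurable ?P" if "j \<le> B" for j
    proof -
      note [measurable] = comp[OF that] comp[OF \<open>i \<le> B\<close>]
      show ?thesis by measurable
    qed
    then have "(\<lambda>v. \<Sum>j\<le>B. of_bool (v j < v i) :: real) \<in> borel_measurable ?P"
      by (intro borel_measurable_sum) simp
    then show ?thesis unfolding R_def by measurable
  qed
  define D where "D i = {\<omega>\<in>space M. m \<le> card {j\<in>{..B}. T j \<omega> < T i \<omega>}}" for i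
  have V: "(\<lambda>\<omega>. \<lambda>j\<in>{..B}. T (p j) \<omega>) \<in> measurable M ?P" if "p permutes {..B}" for p
    using T permutes_in_image[OF that] by (intro measurable_restrict) auto
  have vimR: "(\<lambda>\<omega>. \<lambda>j\<in>{..B}. T (p j) \<omega>) -` R 0 \<inter> space M = D (p 0)" if p: "p permutes {..B}" for p
  proof -
    let ?W = "\<lambda>\<omega>. \<lambda>j\<in>{..B}. T (p j) \<omega>"
    have count: "(\<Sum>j\<le>B. of_bool (?W \<omega> j < ?W \<omega> 0)) = real (card {j\<in>{..B}. T j \<omega> < T (p 0) \<omega>})" for \<omega>
    proof -
      have "(\<Sum>j\<le>B. of_bool (?W \<omega> j < ?W \<omega> 0)) = (\<Sum>j\<le>B. of_bool (T (p j) \<omega> < T (p 0) \<omega>) :: real)"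
        by (intro sum.cong) auto
      also have "\<dots> = (\<Sum>j\<le>B. of_bool (T j \<omega> < T (p 0) \<omega>))"
        using sum.permute[OF p, of "\<lambda>j. of_bool (T j \<omega> < T (p 0) \<omega>) :: real"] by (simp add: comp_def)
      also have "\<dots> = real (card {j\<in>{..B}. T j \<omega> < T (p 0) \<omega>})"
        by (rule sum_of_bool_card) simp
      finally show ?thesis .
    qed
    have "?W \<omega> \<in> R 0 \<longleftrightarrow> \<omega> \<in> D (p 0)" if "\<omega> \<in> space M" for \<omega>
      using measurable_space[OF V[OF p] that] that
      unfolding R_def D_def mem_Collect_eq count by (simp only: of_nat_le_iff simp_thms)
    moreover have "D (p 0) \<subseteq> space M" by (auto simp: D_def)
    ultimately show ?thesis by blast
  qed
  have exch: "measure M (A \<inter> D (p 0)) = measure M (A \<inter> D 0)"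
    if A: "A \<in> sets F" and p: "p permutes {..B}" for A p
  proof -
    have AM: "A \<in> sets M" using A subalg by (auto simp: subalgebra_def)
    \<comment> \<open>The law of the permuted vector on the event \<open>A\<close> is compared with that of the vector itself.\<close>
    let ?M = "density M (indicator A)"
    have dens: "emeasure ?M Z = measure M (A \<inter> Z)" if Z: "Z \<in> sets M" for Z
    proof -
      have "emeasure ?M Z = (\<integral>\<^sup>+\<omega>. indicator A \<omega> * indicator Z \<omega> \<partial>M)"
        using AM Z by (simp add: emeasure_density)
      also have "\<dots> = (\<integral>\<^sup>+\<omega>. indicator (A \<inter> Z) \<omega> \<partial>M)"
        by (intro nn_integral_cong) (simp add: indicator_inter_arith)
      also have "\<dots> = emeasure M (A \<inter> Z)" using AM Z by (intro nn_integral_indicator) auto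
      finally show ?thesis by (simp add: emeasure_eq_measure)
    qed
    have Vd: "(\<lambda>\<omega>. \<lambda>j\<in>{..B}. T (p j) \<omega>) \<in> measurable ?M ?P" if "p permutes {..B}" for p
      using V[OF that] by simp
    have "distr ?M ?P (\<lambda>\<omega>. \<lambda>j\<in>{..B}. T (p j) \<omega>) = distr ?M ?P (\<lambda>\<omega>. \<lambda>j\<in>{..B}. T (id j) \<omega>)"
      (is "?L = ?R")
    proof (rule measure_eqI_PiM_finite[where I="{..B}" and M="\<lambda>_. borel" and A="\<lambda>_. space ?P"])
      fix U :: "nat \<Rightarrow> real set" assume U: "\<And>i. i \<in> {..B} \<Longrightarrow> U i \<in> sets borel"
      define U' where "U' i = (if i \<le> B then U i else UNIV)" for i
      have U': "U' i \<in> sets borel" for i using U by (auto simp: U'_def)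
      have PiE_U: "Pi\<^sub>E {..B} U \<in> sets ?P" using U by (intro sets_PiM_I_finite) auto
      define Z where "Z p = {\<omega>\<in>space M. \<forall>i\<le>B. T i \<omega> \<in> U' (inv p i)}" for p
      have Z: "Z p \<in> sets M" for p unfolding Z_def using U' by (rule boxM)
      have val: "emeasure (distr ?M ?P (\<lambda>\<omega>. \<lambda>j\<in>{..B}. T (p j) \<omega>)) (Pi\<^sub>E {..B} U) = measure M (A \<inter> Z p)"
        if p: "p permutes {..B}" for p
      proof -
        have "(\<forall>j\<le>B. T (p j) \<omega> \<in> U' j) \<longleftrightarrow> (\<forall>i\<le>B. T i \<omega> \<in> U' (inv p i))" for \<omega>
        proof safe
          fix i assume *: "\<forall>j\<le>B. T (p j) \<omega> \<in> U' j" and "i \<le> B"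
          then have "inv p i \<le> B" using permutes_in_image[OF permutes_inv[OF p], of i] by simp
          then show "T i \<omega> \<in> U' (inv p i)" using * permutes_inverses(1)[OF p, of i] by metis
        next
          fix j assume *: "\<forall>i\<le>B. T i \<omega> \<in> U' (inv p i)" and "j \<le> B"
          then have "p j \<le> B" using permutes_in_image[OF p, of j] by simp
          then show "T (p j) \<omega> \<in> U' j" using * permutes_inverses(2)[OF p, of j] by metis
        qed
        moreover have "(\<lambda>\<omega>. \<lambda>j\<in>{..B}. T (p j) \<omega>) -` (Pi\<^sub>E {..B} U) \<inter> space ?M
            = {\<omega>\<in>space M. \<forall>j\<le>B. T (p j) \<omega> \<in> U' j}"
          by (auto simp: PiE_iff U'_def)
        ultimately have "(\<lambda>\<omega>. \<lambda>j\<in>{..B}. T (p j) \<omega>) -` (Pi\<^sub>E {..B} U) \<inter> space ?M = Z p"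
          by (simp add: Z_def)
        then show ?thesis
          using Vd[OF p] PiE_U Z by (simp add: emeasure_distr dens)
      qed
      have boxp: "AE \<omega> in M. real_cond_exp M F (indicator (Z p)) \<omega> = (\<Prod>i\<le>B. q (U' i) \<omega>)"
        if p: "p permutes {..B}" for p
      proof -
        have "(\<Prod>i\<le>B. q (U' (inv p i)) \<omega>) = (\<Prod>i\<le>B. q (U' i) \<omega>)" for \<omega>
          using prod.permute[OF permutes_inv[OF p], of "\<lambda>i. q (U' i) \<omega>"] by (simp add: comp_def)
        then show ?thesis
          using box[of "\<lambda>i. U' (inv p i)", OF U'] by (simp only: Z_def)
      qed
      have "AE \<omega> in M. real_cond_exp M F (indicator (Z p)) \<omega> = real_cond_exp M F (indicator (Z id)) \<omega>"
        using boxp[OF p] boxp[OF permutes_id] by eventually_elim simp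
      then have "(\<integral>\<omega>\<in>A. real_cond_exp M F (indicator (Z p)) \<omega> \<partial>M) = (\<integral>\<omega>\<in>A. real_cond_exp M F (indicator (Z id)) \<omega> \<partial>M)"
        using AM unfolding set_lebesgue_integral_def by (intro integral_cong_AE) auto
      then have "measure M (A \<inter> Z p) = measure M (A \<inter> Z id)"
        by (simp add: measure_Int_eq_cond_exp[OF fin Z A])
      then show "emeasure ?L (Pi\<^sub>E {..B} U) = emeasure ?R (Pi\<^sub>E {..B} U)"
        unfolding val[OF p] val[OF permutes_id] by simp
    next
      have "space ?P = Pi\<^sub>E {..B} (\<lambda>_. UNIV)" by (simp add: space_PiM)
      then show "range (\<lambda>_::nat. space ?P) \<subseteq> prod_algebra {..B} (\<lambda>_. borel)"
        by (auto intro!: prod_algebraI_finite)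
    next
      show "emeasure ?L (space ?P) \<noteq> \<infinity>"
        using Vd[OF p] dens[OF measurable_sets[OF V[OF p] sets.top]] by (simp add: emeasure_distr)
    qed auto
    then have "emeasure ?L (R 0) = emeasure ?R (R 0)" by simp
    then have "emeasure ?M (D (p 0)) = emeasure ?M (D 0)"
      using Vd[OF p] Vd[OF permutes_id] Rs[of 0] vimR[OF p] vimR[OF permutes_id] by (simp add: emeasure_distr)
    moreover have "D (p 0) \<in> sets M" "D 0 \<in> sets M"
      using measurable_sets[OF V[OF p] Rs[of 0]] measurable_sets[OF V[OF permutes_id] Rs[of 0]]
        vimR[OF p] vimR[OF permutes_id] by simp_all
    ultimately show ?thesis using dens by simp
  qed
  have tr: "Transposition.transpose 0 i permutes {..B}" if "i \<le> B" for i :: nat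
    using that by (intro permutes_swap_id) auto
  have Ds: "D i \<in> sets M" if "i \<le> B" for i
    using measurable_sets[OF V[OF tr[OF that]] Rs[of 0]] vimR[OF tr[OF that]] by simp
  have int: "integrable M (indicator (D i) :: _ \<Rightarrow> real)" if "i \<le> B" for i
    using Ds[OF that] by (auto simp: integrable_indicator_iff less_top[symmetric])
  let ?E = "real_cond_exp M F"
  have eqi: "AE \<omega> in M. \<forall>i\<in>{..B}. ?E (indicator (D i)) \<omega> = ?E (indicator (D 0)) \<omega>"
  proof (rule AE_finite_allI)
    fix i assume "i \<in> {..B}"
    then have i: "i \<le> B" by simp
    show "AE \<omega> in M. ?E (indicator (D i)) \<omega> = ?E (indicator (D 0)) \<omega>"
      using exch[OF _ tr[OF i]] by (intro cond_exp_indicator_cong[OF fin] Ds i) auto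
  qed simp
  \<comment> \<open>The sum rule for conditional expectations asks for integrability at every index, hence the default \<open>0\<close>.\<close>
  let ?f = "\<lambda>i. if i \<le> B then indicator (D i) else (\<lambda>_. 0) :: 'w \<Rightarrow> real"
  have fint: "integrable M (?f i)" for i using int by auto
  have "AE \<omega> in M. ?E (\<lambda>\<omega>. \<Sum>i\<in>{..B}. ?f i \<omega>) \<omega> = (\<Sum>i\<in>{..B}. ?E (?f i) \<omega>)"
    using fint by (rule real_cond_exp_sum)
  moreover have "AE \<omega> in M. ?E (\<lambda>\<omega>. \<Sum>i\<in>{..B}. ?f i \<omega>) \<omega> \<le> ?E (\<lambda>_. real B + 1 - real m) \<omega>"
  proof (rule real_cond_exp_mono)
    show "AE \<omega> in M. (\<Sum>i\<in>{..B}. ?f i \<omega>) \<le> real B + 1 - real m"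
    proof (rule AE_I2)
      fix \<omega> assume \<omega>: "\<omega> \<in> space M"
      have "(\<Sum>i\<in>{..B}. ?f i \<omega>) = (\<Sum>i\<in>{..B}. of_bool (m \<le> card {j\<in>{..B}. T j \<omega> < T i \<omega>}))"
        using \<omega> by (intro sum.cong) (auto simp: D_def)
      also have "\<dots> = real (card {i\<in>{..B}. m \<le> card {j\<in>{..B}. T j \<omega> < T i \<omega>}})"
        by (rule sum_of_bool_card) simp
      finally show "(\<Sum>i\<in>{..B}. ?f i \<omega>) \<le> real B + 1 - real m"
        using card_many_smaller_le[of "{..B}" m "\<lambda>j. T j \<omega>"] m by simp
    qed
    show "integrable M (\<lambda>\<omega>. \<Sum>i\<in>{..B}. ?f i \<omega>)"
      using fint by (rule Bochner_Integration.integrable_sum)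
  qed simp
  moreover have "AE \<omega> in M. ?E (\<lambda>_. real B + 1 - real m) \<omega> = real B + 1 - real m"
    by (rule real_cond_exp_F_meas) auto
  ultimately have "AE \<omega> in M. ?E (indicator (D 0)) \<omega> \<le> (real B + 1 - real m) / (real B + 1)"
    using eqi
  proof eventually_elim
    case (elim \<omega>)
    have "(\<Sum>i\<in>{..B}. ?E (?f i) \<omega>) = (\<Sum>i\<in>{..B}. ?E (indicator (D 0)) \<omega>)"
    proof (rule sum.cong)
      fix i assume i: "i \<in> {..B}"
      then show "?E (?f i) \<omega> = ?E (indicator (D 0)) \<omega>"
        using bspec[OF elim(4) i] by (simp only: atMost_iff if_True)
    qed simp
    then have "(real B + 1) * ?E (indicator (D 0)) \<omega> \<le> real B + 1 - real m"
      using elim(1-3) by (simp add: algebra_simps)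
    then show ?case by (simp add: field_simps)
  qed
  then show ?thesis by (simp add: D_def)
qed

section \<open>The sample marks are conditionally Rademacher\<close>

locale marked_poisson_pair = poisson_pair M X \<Lambda> N1 Nm1
  for M :: "'w measure" and X \<Lambda> :: "'a measure" and N1 Nm1 +
  fixes B :: nat and m :: "'w \<Rightarrow> 'a \<Rightarrow> nat \<Rightarrow> real"
  assumes marks: "cond_iid_marks M X pool (mark_vec_space B) (rademacher_vec B) m"
begin

abbreviation "Y \<equiv> X \<Otimes>\<^sub>M mark_vec_space B"
abbreviation "given_pool \<equiv> \<lambda>R. real_cond_exp (completion M) (generated_by M X pool) (indicator R)"

lemma measurable_marks: "(\<lambda>\<omega>. marked_points (m \<omega>) (pool \<omega>)) \<in> measurable (completion M) (config_space Y)"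
  using marks by (simp add: cond_iid_marks_def)

lemma marks_in_space: "\<omega> \<in> space M \<Longrightarrow> marked_points (m \<omega>) (pool \<omega>) \<in> space (config_space Y)"
  using measurable_space[OF measurable_marks] by simp

lemma cond_prob_marks:
  assumes "F \<in> sets (config_space Y)"
  shows "AE \<omega> in completion M. given_pool {\<omega>\<in>space M. marked_points (m \<omega>) (pool \<omega>) \<in> F} \<omega>
    = measure_pmf.prob (Pi_pmf (pool \<omega>) undefined (\<lambda>_. rademacher_vec B)) {y. marked_points y (pool \<omega>) \<in> F}"
  using marks assms by (intro AE_completion) (simp add: cond_iid_marks_def cond_prob_given_def)

lemma measurable_component_mark:
  "b \<in> {1..B} \<Longrightarrow> (\<lambda>v. v b) \<in> borel_measurable (mark_vec_space B)"
  unfolding mark_vec_space_def by (rule measurable_component_singleton)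

lemma sets_component_marks:
  assumes b: "b \<in> {1..B}" and E: "E \<in> sets (X \<Otimes>\<^sub>M borel)"
  shows "{z \<in> space Y. (fst z, snd z b) \<in> E} \<in> sets Y"
proof -
  have "(\<lambda>z. (fst z, snd z b)) \<in> measurable Y (X \<Otimes>\<^sub>M borel)"
    using measurable_compose[OF measurable_snd measurable_component_mark[OF b], of X] by measurable
  from measurable_sets[OF this E] show ?thesis
    by (simp add: vimage_def Int_def conj_commute)
qed

lemma num_points_component_marks:
  assumes "\<omega> \<in> space M"
  shows "num_points (marked_points (\<lambda>x. m \<omega> x b) (pool \<omega>)) E
    = num_points (marked_points (m \<omega>) (pool \<omega>)) {z \<in> space Y. (fst z, snd z b) \<in> E}"
  unfolding num_points_marked_points
  using marks_in_space[OF assms]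
  by (intro num_points_cong) (auto simp: space_config_space marked_points_def)

lemma measurable_component_marks:
  assumes b: "b \<in> {1..B}"
  shows "(\<lambda>\<omega>. marked_points (\<lambda>x. m \<omega> x b) (pool \<omega>)) \<in> measurable (completion M) (config_space (X \<Otimes>\<^sub>M borel))"
proof (rule measurable_config_spaceI)
  fix E :: "('a \<times> real) set" assume E: "E \<in> sets (X \<Otimes>\<^sub>M borel)"
  have "(\<lambda>\<omega>. num_points (marked_points (m \<omega>) (pool \<omega>)) {z \<in> space Y. (fst z, snd z b) \<in> E})
      \<in> borel_measurable (completion M)"
    using measurable_compose[OF measurable_marks measurable_num_points[OF sets_component_marks[OF b E]]] .
  then show "(\<lambda>\<omega>. num_points (marked_points (\<lambda>x. m \<omega> x b) (pool \<omega>)) E) \<in> borel_measurable (completion M)"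
    by (subst measurable_cong[OF num_points_component_marks]) auto
qed (simp add: marked_pool_in_space)

text \<open>
  Given the pooled process, the resampled signs avoid \<open>E\<close> with a probability that is a product over
  the points; it splits into a factor for each of the two independent samples.
\<close>

lemma prob_component_marks_avoid:
  assumes b: "b \<in> {1..B}" and E: "E \<in> sets (X \<Otimes>\<^sub>M borel)"
  shows "measure (completion M) {\<omega>\<in>space M. marked_points (\<lambda>x. m \<omega> x b) (pool \<omega>) \<inter> E = {}}
    = exp (- measure \<Lambda> {x \<in> space X. (x, 1) \<in> E} - measure \<Lambda> {x \<in> space X. (x, -1) \<in> E})"
proof -
  let ?A = "\<lambda>s. {x \<in> space X. (x, s) \<in> E}"
  have A: "?A s \<in> sets X" for s by (rule sets_section_space[OF E])
  \<comment> \<open>Avoiding \<open>E\<close> with the \<open>b\<close>-th signs is avoiding \<open>?E\<close> with the sign vectors.\<close>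
  let ?E = "{z \<in> space Y. (fst z, snd z b) \<in> E}"
  let ?F = "{\<xi> \<in> space (config_space Y). \<xi> \<inter> ?E = {}}"
  let ?R = "{\<omega>\<in>space M. marked_points (m \<omega>) (pool \<omega>) \<in> ?F}"
  have "{\<xi> \<in> space (config_space Y). num_points \<xi> ?E = 0} \<in> sets (config_space Y)"
    using measurable_num_points[OF sets_component_marks[OF b E]] by measurable
  then have F: "?F \<in> sets (config_space Y)" by (simp only: num_points_eq_0_iff)
  have R: "{\<omega>\<in>space M. marked_points (\<lambda>x. m \<omega> x b) (pool \<omega>) \<inter> E = {}} = ?R"
  proof -
    have "marked_points (\<lambda>x. m \<omega> x b) (pool \<omega>) \<inter> E = {} \<longleftrightarrow> marked_points (m \<omega>) (pool \<omega>) \<inter> ?E = {}"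
      if "\<omega> \<in> space M" for \<omega>
      unfolding num_points_eq_0_iff[symmetric] num_points_component_marks[OF that] ..
    then show ?thesis using marks_in_space by blast
  qed
  have Rs: "?R \<in> sets (completion M)"
    using measurable_sets[OF measurable_marks F] by (simp add: vimage_def Int_def conj_commute)
  let ?w = "\<lambda>S. of_bool (S \<inter> (?A 1 \<inter> ?A (-1)) = {})
      * half_power (num_points S ((?A 1 - ?A (-1)) \<union> (?A (-1) - ?A 1)))"
  have cond_w: "AE \<omega> in completion M. given_pool ?R \<omega> = ?w (N1 \<omega>) * ?w (Nm1 \<omega>)"
    using cond_prob_marks[OF F] AE_completion[OF AE_finite] AE_completion[OF AE_disjoint] AE_space
  proof eventually_elim
    case (elim \<omega>)
    let ?g = "\<lambda>x. (of_bool (x \<notin> ?A 1) + of_bool (x \<notin> ?A (-1))) / 2 :: real"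
    have S: "pool \<omega> \<subseteq> space X" using pool_in_space elim(4) by (auto simp: space_config_space)
    have fin: "finite (N1 \<omega>)" "finite (Nm1 \<omega>)" using elim(2) by (auto simp: pooled_def)
    have "given_pool ?R \<omega> = (\<Prod>x\<in>pool \<omega>. (of_bool ((x, 1) \<notin> E) + of_bool ((x, -1) \<notin> E)) / 2)"
      using elim(1) prob_Pi_rademacher_vec_avoid[OF elim(2) S b, of E] by (simp only:)
    also have "\<dots> = (\<Prod>x\<in>pool \<omega>. ?g x)"
      using S by (intro prod.cong) auto
    also have "\<dots> = (\<Prod>x\<in>N1 \<omega>. ?g x) * (\<Prod>x\<in>Nm1 \<omega>. ?g x)"
      unfolding pooled_def by (rule prod.union_disjoint[OF fin elim(3)])
    also have "\<dots> = ?w (N1 \<omega>) * ?w (Nm1 \<omega>)"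
      by (simp only: prod_avoid_weight[OF fin(1)] prod_avoid_weight[OF fin(2)])
    finally show ?case .
  qed
  have wm: "(\<lambda>\<omega>. ?w (N1 \<omega>) * ?w (Nm1 \<omega>)) \<in> borel_measurable M"
    by (rule expectation_avoid_weight(2)[OF A A])
  have int: "integrable (completion M) (indicator ?R :: _ \<Rightarrow> real)"
    using Rs by (auto simp: integrable_indicator_iff less_top[symmetric])
  have "measure (completion M) ?R = (\<integral>\<omega>. indicator ?R \<omega> \<partial>completion M)"
  proof -
    have "?R \<inter> space (completion M) = ?R" by auto
    then show ?thesis by (simp only: Bochner_Integration.integral_indicator)
  qed
  also have "\<dots> = (\<integral>\<omega>. given_pool ?R \<omega> \<partial>completion M)"
    by (rule cond.real_cond_exp_int(2)[OF int, symmetric])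
  also have "\<dots> = (\<integral>\<omega>. ?w (N1 \<omega>) * ?w (Nm1 \<omega>) \<partial>completion M)"
    using cond_w wm cond.real_cond_exp_int(1)[OF int]
    by (intro integral_cong_AE) (auto intro: measurable_completion)
  also have "\<dots> = (\<integral>\<omega>. ?w (N1 \<omega>) * ?w (Nm1 \<omega>) \<partial>M)"
    using wm by (rule integral_completion)
  also have "\<dots> = exp (- measure \<Lambda> (?A 1) - measure \<Lambda> (?A (-1)))"
    by (rule expectation_avoid_weight(1)[OF A A])
  finally show ?thesis unfolding R .
qed

lemma same_law_sample_component_marks:
  assumes b: "b \<in> {1..B}" and F: "F \<in> sets (config_space (X \<Otimes>\<^sub>M borel))"
  shows "measure (completion M) {\<omega>\<in>space M. marked_points (sample_mark N1 \<omega>) (pool \<omega>) \<in> F}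
    = measure (completion M) {\<omega>\<in>space M. marked_points (\<lambda>x. m \<omega> x b) (pool \<omega>) \<in> F}"
proof -
  obtain P where P: "separating X P" "AE \<omega> in M. separated_by P (pool \<omega>)"
    by (rule AE_separated)
  let ?P = "\<lambda>k. (\<lambda>D. D \<times> UNIV) ` P k"
  have sep: "AE \<omega> in completion M. separated_by ?P (marked_points (e \<omega>) (pool \<omega>))" for e :: "_ \<Rightarrow> _ \<Rightarrow> real"
    using AE_completion[OF P(2)] by eventually_elim (rule separated_by_marked_points)
  show ?thesis
    using law_determined_by_avoidance[OF C.prob_space_axioms measurable_sample_marks sep
        measurable_component_marks[OF b] sep separating_times_UNIV[OF P(1)] _ F]
      prob_sample_marks_avoid prob_component_marks_avoid[OF b]
    by simp
qed

text \<open>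
  An event of the pooled process is also an event of the marked configuration, so equal laws of the
  marked configurations give equal conditional laws.
\<close>

lemma cond_prob_sample_component:
  assumes b: "b \<in> {1..B}" and F: "F \<in> sets (config_space (X \<Otimes>\<^sub>M borel))"
  shows "AE \<omega> in completion M.
    given_pool {\<omega>\<in>space M. marked_points (sample_mark N1 \<omega>) (pool \<omega>) \<in> F} \<omega>
    = given_pool {\<omega>\<in>space M. marked_points (\<lambda>x. m \<omega> x b) (pool \<omega>) \<in> F} \<omega>"
proof (rule cond_exp_indicator_cong[OF cond.finite_measure_subalgebra_axioms])
  show "{\<omega>\<in>space M. marked_points (sample_mark N1 \<omega>) (pool \<omega>) \<in> F} \<in> sets (completion M)"
    using measurable_sets[OF measurable_sample_marks F] by (simp add: vimage_def Int_def conj_commute)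
  show "{\<omega>\<in>space M. marked_points (\<lambda>x. m \<omega> x b) (pool \<omega>) \<in> F} \<in> sets (completion M)"
    using measurable_sets[OF measurable_component_marks[OF b] F] by (simp add: vimage_def Int_def conj_commute)
next
  fix A assume A: "A \<in> sets (generated_by M X pool)"
  obtain E where E: "E \<in> sets (config_space (X \<Otimes>\<^sub>M (borel :: real measure)))"
    "\<And>\<omega> e. \<omega> \<in> space M \<Longrightarrow> \<omega> \<in> A \<longleftrightarrow> marked_points e (pool \<omega>) \<in> E"
    using generated_by_marked_points[OF pool_in_space A] by blast
  have "A \<subseteq> space M"
    using sets.sets_into_space[OF A] by (simp add: generated_by_def)
  then have "A \<inter> {\<omega>\<in>space M. marked_points (e \<omega>) (pool \<omega>) \<in> F}
      = {\<omega>\<in>space M. marked_points (e \<omega>) (pool \<omega>) \<in> E \<inter> F}" for e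
    using E(2) by blast
  then show "measure (completion M) (A \<inter> {\<omega>\<in>space M. marked_points (sample_mark N1 \<omega>) (pool \<omega>) \<in> F})
      = measure (completion M) (A \<inter> {\<omega>\<in>space M. marked_points (\<lambda>x. m \<omega> x b) (pool \<omega>) \<in> F})"
    using same_law_sample_component_marks[OF b, of "E \<inter> F"] E(1) F by simp
qed

end

section \<open>The level of the Monte Carlo test\<close>

locale monte_carlo_test = marked_poisson_pair M X \<Lambda> N1 Nm1 B m
  for M :: "'w measure" and X \<Lambda> :: "'a measure" and N1 Nm1 B m +
  fixes K :: "'a \<Rightarrow> 'a \<Rightarrow> real"
  assumes K: "(\<lambda>(x, x'). K x x') \<in> borel_measurable (X \<Otimes>\<^sub>M X)"
    and cond_indep: "cond_indep_marks M X pool borel (sample_mark N1) (mark_vec_space B) m"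
    and B: "B \<ge> 1"
begin

text \<open>
  Index \<open>0\<close> is the observed statistic, so that all \<open>B + 1\<close> statistics form one family.
\<close>

definition stat :: "nat \<Rightarrow> 'w \<Rightarrow> real" where
  "stat b \<omega> = T_stat K (pool \<omega>) (if b = 0 then sample_mark N1 \<omega> else (\<lambda>x. m \<omega> x b))"

lemma stat_0: "stat 0 \<omega> = marked_stat K (\<lambda>s. s) (marked_points (sample_mark N1 \<omega>) (pool \<omega>))"
  by (simp add: stat_def marked_stat_marked_points)

lemma stat_real: "b \<in> {1..B} \<Longrightarrow> stat b \<omega> = marked_stat K (\<lambda>s. s) (marked_points (\<lambda>x. m \<omega> x b) (pool \<omega>))"
  by (simp add: stat_def marked_stat_marked_points)

lemma stat_vec: "b \<in> {1..B} \<Longrightarrow> stat b \<omega> = marked_stat K (\<lambda>v. v b) (marked_points (m \<omega>) (pool \<omega>))"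
  by (simp add: stat_def marked_stat_marked_points)

lemma measurable_stat:
  assumes "b \<le> B"
  shows "stat b \<in> borel_measurable (completion M)"
proof -
  have s: "marked_stat K (\<lambda>s. s) \<in> borel_measurable (config_space (X \<Otimes>\<^sub>M borel))"
    by (rule measurable_marked_stat[OF K]) simp
  show ?thesis
  proof (cases "b = 0")
    case True
    show ?thesis unfolding True stat_0[abs_def] by (rule measurable_compose[OF measurable_sample_marks s])
  next
    case False
    then have "b \<in> {1..B}" using assms by simp
    then show ?thesis
      using measurable_compose[OF measurable_component_marks s] stat_real by (simp cong: measurable_cong)
  qed
qed

definition stat_cond_prob :: "real set \<Rightarrow> 'w \<Rightarrow> real" where
  "stat_cond_prob U = given_pool {\<omega>\<in>space M. stat 1 \<omega> \<in> U}"

lemma cond_prob_stat_0: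
  assumes "U \<in> sets borel"
  shows "AE \<omega> in completion M. given_pool {\<omega>\<in>space M. stat 0 \<omega> \<in> U} \<omega> = stat_cond_prob U \<omega>"
proof -
  let ?F = "{\<xi> \<in> space (config_space (X \<Otimes>\<^sub>M borel)). marked_stat K (\<lambda>s. s) \<xi> \<in> U}"
  have s: "marked_stat K (\<lambda>s. s) \<in> borel_measurable (config_space (X \<Otimes>\<^sub>M borel))"
    by (rule measurable_marked_stat[OF K]) simp
  have F: "?F \<in> sets (config_space (X \<Otimes>\<^sub>M borel))"
    using measurable_sets[OF s assms] by (simp add: vimage_def Int_def conj_commute)
  have 1: "1 \<in> {1..B}" using B by simp
  have "{\<omega>\<in>space M. marked_points (sample_mark N1 \<omega>) (pool \<omega>) \<in> ?F} = {\<omega>\<in>space M. stat 0 \<omega> \<in> U}"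
    using marked_pool_in_space by (auto simp: stat_0)
  moreover have "{\<omega>\<in>space M. marked_points (\<lambda>x. m \<omega> x 1) (pool \<omega>) \<in> ?F} = {\<omega>\<in>space M. stat 1 \<omega> \<in> U}"
    using marked_pool_in_space by (auto simp: stat_real[OF 1] simp del: One_nat_def)
  ultimately show ?thesis
    using cond_prob_sample_component[OF 1 F] unfolding stat_cond_prob_def by (simp only:)
qed

definition stat_box :: "(nat \<Rightarrow> real set) \<Rightarrow> ('a \<times> (nat \<Rightarrow> real)) set set" where
  "stat_box U = {\<xi> \<in> space (config_space Y). \<forall>b\<in>{1..B}. marked_stat K (\<lambda>v. v b) \<xi> \<in> U b}"

lemma stat_box_sets:
  assumes "\<And>b. U b \<in> sets borel"
  shows "stat_box U \<in> sets (config_space Y)"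
proof -
  have "(\<Inter>b\<in>{1..B}. marked_stat K (\<lambda>v. v b) -` U b \<inter> space (config_space Y)) \<in> sets (config_space Y)"
    using B assms
    by (intro sets.finite_INT measurable_sets[OF measurable_marked_stat[OF K measurable_component_mark]]) auto
  moreover have "(\<Inter>b\<in>{1..B}. marked_stat K (\<lambda>v. v b) -` U b \<inter> space (config_space Y)) = stat_box U"
    using B by (auto simp: stat_box_def)
  ultimately show ?thesis by (simp only:)
qed

lemma marks_in_stat_box_iff:
  assumes "\<omega> \<in> space M"
  shows "marked_points (m \<omega>) (pool \<omega>) \<in> stat_box U \<longleftrightarrow> (\<forall>b\<in>{1..B}. stat b \<omega> \<in> U b)"
  using marks_in_space[OF assms] by (auto simp: stat_box_def stat_vec)

lemma prob_Pi_stat_box: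
  assumes S: "finite S" "S \<subseteq> space X"
  shows "measure_pmf.prob (Pi_pmf S undefined (\<lambda>_. rademacher_vec B)) {y. marked_points y S \<in> stat_box U}
    = measure_pmf.prob (Pi_pmf S undefined (\<lambda>_. rademacher_vec B))
        {y. \<forall>b\<in>{1..B}. (\<lambda>x. y x b) \<in> {e. T_stat K S e \<in> U b}}"
proof -
  let ?p = "Pi_pmf S undefined (\<lambda>_. rademacher_vec B)"
  have iff: "marked_points y S \<in> stat_box U \<longleftrightarrow> (\<forall>b\<in>{1..B}. (\<lambda>x. y x b) \<in> {e. T_stat K S e \<in> U b})"
    if "y \<in> set_pmf ?p" for y
  proof -
    have "y x \<in> space (mark_vec_space B)" if "x \<in> S" for x
      using set_Pi_pmf_subset'[OF S(1)] set_pmf_rademacher_vec that \<open>y \<in> set_pmf ?p\<close>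
      by (fastforce simp: PiE_dflt_def)
    then have "marked_points y S \<in> space (config_space Y)"
      using S by (auto simp: space_config_space marked_points_def space_pair_measure countable_finite)
    then show ?thesis by (simp add: stat_box_def marked_stat_marked_points)
  qed
  show ?thesis
    by (rule measure_prob_cong_0) (use iff in \<open>auto simp: set_pmf_iff\<close>)
qed

text \<open>
  For finitely many points the product law of the sign vectors factorizes over the \<open>B\<close> resamplings,
  and all factors are instances of the conditional law of the first resampled statistic.
\<close>

lemma cond_prob_stats:
  assumes U: "\<And>b. U b \<in> sets borel"
  shows "AE \<omega> in completion M. given_pool {\<omega>\<in>space M. \<forall>b\<in>{1..B}. stat b \<omega> \<in> U b} \<omega>
    = (\<Prod>b\<in>{1..B}. stat_cond_prob (U b) \<omega>)"
proof -
  let ?Q = "\<lambda>\<omega> V. measure_pmf.prob (Pi_pmf (pool \<omega>) 0 (\<lambda>_. rademacher)) {e. T_stat K (pool \<omega>) e \<in> V}"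
  have all: "AE \<omega> in completion M. given_pool {\<omega>\<in>space M. \<forall>b\<in>{1..B}. stat b \<omega> \<in> V b} \<omega> = (\<Prod>b\<in>{1..B}. ?Q \<omega> (V b))"
    if V: "\<And>b. V b \<in> sets borel" for V
  proof -
    have ev: "{\<omega>\<in>space M. marked_points (m \<omega>) (pool \<omega>) \<in> stat_box V} = {\<omega>\<in>space M. \<forall>b\<in>{1..B}. stat b \<omega> \<in> V b}"
      using marks_in_stat_box_iff by blast
    show ?thesis
      using cond_prob_marks[OF stat_box_sets[of V, OF V]] AE_completion[OF AE_finite] AE_space unfolding ev
    proof eventually_elim
      case (elim \<omega>)
      have S: "pool \<omega> \<subseteq> space X" using pool_in_space elim(3) by (auto simp: space_config_space)
      have "measure_pmf.prob (Pi_pmf (pool \<omega>) undefined (\<lambda>_. rademacher_vec B))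
          {y. \<forall>b\<in>{1..B}. (\<lambda>x. y x b) \<in> {e. T_stat K (pool \<omega>) e \<in> V b}} = (\<Prod>b\<in>{1..B}. ?Q \<omega> (V b))"
      proof (rule prob_rademacher_vec_factor[OF elim(2)])
        show "e \<in> {e. T_stat K (pool \<omega>) e \<in> V b} \<longleftrightarrow> e' \<in> {e. T_stat K (pool \<omega>) e \<in> V b}"
          if "\<And>x. x \<in> pool \<omega> \<Longrightarrow> e x = e' x" for b e e'
          using T_stat_cong[of "pool \<omega>" e e' K] that by simp
      qed
      then show ?case
        unfolding elim(1) prob_Pi_stat_box[OF elim(2) S] .
    qed
  qed
  have one: "AE \<omega> in completion M. stat_cond_prob V \<omega> = ?Q \<omega> V" if V: "V \<in> sets borel" for V
  proof -
    \<comment> \<open>Constraining the first statistic alone turns the product into a single factor.\<close>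
    let ?V = "\<lambda>b. if b = 1 then V else UNIV"
    have "(\<forall>b\<in>{1..B}. stat b \<omega> \<in> ?V b) \<longleftrightarrow> stat 1 \<omega> \<in> V" for \<omega> using B by auto
    moreover have "(\<Prod>b\<in>{1..B}. ?Q \<omega> (?V b)) = ?Q \<omega> V" for \<omega>
    proof -
      have "(\<Prod>b\<in>{1..B}. ?Q \<omega> (?V b)) = (\<Prod>b\<in>{1..B}. if b = 1 then ?Q \<omega> V else 1)"
        by (intro prod.cong) auto
      then show ?thesis using B by simp
    qed
    ultimately show ?thesis using all[of ?V] V by (simp only: stat_cond_prob_def) simp
  qed
  have "AE \<omega> in completion M. \<forall>b\<in>{1..B}. stat_cond_prob (U b) \<omega> = ?Q \<omega> (U b)"
    using one[OF U] by (intro AE_finite_allI) auto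
  then show ?thesis
    using all[of U, OF U] by eventually_elim simp
qed

lemma cond_prob_all_stats:
  assumes U: "\<And>b. U b \<in> sets borel"
  shows "AE \<omega> in completion M. given_pool {\<omega>\<in>space M. \<forall>b\<le>B. stat b \<omega> \<in> U b} \<omega>
    = (\<Prod>b\<le>B. stat_cond_prob (U b) \<omega>)"
proof -
  let ?F = "{\<xi> \<in> space (config_space (X \<Otimes>\<^sub>M borel)). marked_stat K (\<lambda>s. s) \<xi> \<in> U 0}"
  have s: "marked_stat K (\<lambda>s. s) \<in> borel_measurable (config_space (X \<Otimes>\<^sub>M borel))"
    by (rule measurable_marked_stat[OF K]) simp
  have F: "?F \<in> sets (config_space (X \<Otimes>\<^sub>M borel))"
    using measurable_sets[OF s U] by (simp add: vimage_def Int_def conj_commute)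
  have ev0: "{\<omega>\<in>space M. marked_points (sample_mark N1 \<omega>) (pool \<omega>) \<in> ?F} = {\<omega>\<in>space M. stat 0 \<omega> \<in> U 0}"
    using marked_pool_in_space by (auto simp: stat_0)
  have ev1: "{\<omega>\<in>space M. marked_points (m \<omega>) (pool \<omega>) \<in> stat_box U} = {\<omega>\<in>space M. \<forall>b\<in>{1..B}. stat b \<omega> \<in> U b}"
    using marks_in_stat_box_iff by blast
  have split: "{..B} = insert 0 {1..B}" by auto
  have ev: "{\<omega>\<in>space M. marked_points (sample_mark N1 \<omega>) (pool \<omega>) \<in> ?F \<and> marked_points (m \<omega>) (pool \<omega>) \<in> stat_box U}
      = {\<omega>\<in>space M. \<forall>b\<le>B. stat b \<omega> \<in> U b}"
  proof -
    have "(\<forall>b\<le>B. stat b \<omega> \<in> U b) \<longleftrightarrow> stat 0 \<omega> \<in> U 0 \<and> (\<forall>b\<in>{1..B}. stat b \<omega> \<in> U b)" for \<omega>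
      using split by (metis atMost_iff insert_iff)
    then show ?thesis using ev0 ev1 by blast
  qed
  have "AE \<omega> in completion M.
      given_pool {\<omega>\<in>space M. marked_points (sample_mark N1 \<omega>) (pool \<omega>) \<in> ?F \<and> marked_points (m \<omega>) (pool \<omega>) \<in> stat_box U} \<omega>
      = given_pool {\<omega>\<in>space M. marked_points (sample_mark N1 \<omega>) (pool \<omega>) \<in> ?F} \<omega>
        * given_pool {\<omega>\<in>space M. marked_points (m \<omega>) (pool \<omega>) \<in> stat_box U} \<omega>"
    using cond_indep F stat_box_sets[of U, OF U] unfolding cond_indep_marks_def cond_prob_given_def
    by (intro AE_completion) blast
  then show ?thesis
    using cond_prob_stat_0[OF U[of 0]] cond_prob_stats[of U, OF U] unfolding ev ev0 ev1
    by eventually_elim (simp add: split)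
qed

lemma monte_carlo_level:
  assumes \<alpha>: "0 < \<alpha>" "\<alpha> < 1"
  defines "R \<equiv> {\<omega>\<in>space M. mc_quantile K B \<alpha> (pool \<omega>) (\<lambda>b x. m \<omega> x b) < T_stat K (pool \<omega>) (sample_mark N1 \<omega>)}"
  shows "R \<in> sets (completion M)"
    and "AE \<omega> in M. given_pool R \<omega> \<le> (of_int \<lfloor>real B * \<alpha>\<rfloor> + 1) / (real B + 1)"
proof -
  define k where "k = B - nat \<lfloor>real B * \<alpha>\<rfloor>"
  note q = mc_quantile_less_iff[OF B \<alpha>, folded k_def]
  have R: "R = {\<omega>\<in>space M. k \<le> card {j\<in>{..B}. stat j \<omega> < stat 0 \<omega>}}"
  proof -
    have "{b\<in>{1..B}. T_stat K (pool \<omega>) (\<lambda>x. m \<omega> x b) < T_stat K (pool \<omega>) (sample_mark N1 \<omega>)}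
        = {j\<in>{..B}. stat j \<omega> < stat 0 \<omega>}" for \<omega>
    proof -
      have "j \<in> {1..B} \<and> T_stat K (pool \<omega>) (\<lambda>x. m \<omega> x j) < T_stat K (pool \<omega>) (sample_mark N1 \<omega>)
          \<longleftrightarrow> j \<in> {..B} \<and> stat j \<omega> < stat 0 \<omega>" for j
        by (cases "j = 0") (auto simp: stat_def)
      then show ?thesis by blast
    qed
    then show ?thesis unfolding R_def q(1) by simp
  qed
  have "(\<lambda>\<omega>. \<Sum>j\<le>B. of_bool (stat j \<omega> < stat 0 \<omega>) :: real) \<in> borel_measurable (completion M)"
  proof (intro borel_measurable_sum)
    fix j assume "j \<in> {..B}"
    then have [measurable]: "stat j \<in> borel_measurable (completion M)" "stat 0 \<in> borel_measurable (completion M)"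
      by (auto intro: measurable_stat)
    show "(\<lambda>\<omega>. of_bool (stat j \<omega> < stat 0 \<omega>) :: real) \<in> borel_measurable (completion M)"
      by measurable
  qed
  then have "{\<omega>\<in>space (completion M). real k \<le> (\<Sum>j\<le>B. of_bool (stat j \<omega> < stat 0 \<omega>))} \<in> sets (completion M)"
    by measurable
  then show "R \<in> sets (completion M)"
    unfolding R by (simp only: sum_of_bool_card[OF finite_atMost] of_nat_le_iff space_completion)
  have "AE \<omega> in completion M. given_pool R \<omega> \<le> (real B + 1 - real k) / (real B + 1)"
    using exchangeable_rank_bound[OF cond.finite_measure_subalgebra_axioms measurable_stat
        cond_prob_all_stats[folded space_completion[of M]] q(4)]
    unfolding R by (simp only: space_completion)
  moreover have "real B + 1 - real k = of_int \<lfloor>real B * \<alpha>\<rfloor> + 1"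
    using arg_cong[OF q(2), of real_of_int] by simp
  ultimately show "AE \<omega> in M. given_pool R \<omega> \<le> (of_int \<lfloor>real B * \<alpha>\<rfloor> + 1) / (real B + 1)"
    by (simp only: AE_completion_iff)
qed

end

lemma mc_quantile_cong:
  assumes "\<And>b. b \<in> {1..B} \<Longrightarrow> e b = e' b"
  shows "mc_quantile K B \<alpha> S e = mc_quantile K B \<alpha> S e'"
proof -
  have "mc_cdf K B S e t = mc_cdf K B S e' t" for t
    unfolding mc_cdf_def using assms by (intro arg_cong2[where f="(*)"] refl sum.cong) auto
  then show ?thesis by (simp add: mc_quantile_def)
qed

theorem proposition3:
  fixes M :: "'w measure" and \<nu> :: "'a measure"
    and n \<alpha> :: real and B :: nat
    and f g :: "'a \<Rightarrow> real" and K :: "'a \<Rightarrow> 'a \<Rightarrow> real"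
    and N1 Nm1 N :: "'w \<Rightarrow> 'a set"
    and \<epsilon>0 :: "'w \<Rightarrow> 'a \<Rightarrow> real" and \<epsilon> :: "nat \<Rightarrow> 'w \<Rightarrow> 'a \<Rightarrow> real"
  assumes M: "prob_space M"
    and \<nu>: "sigma_finite_measure \<nu>" "non_atomic \<nu>"
    and n: "n > 0"
    and f: "integrable \<nu> f" "\<forall>x\<in>space \<nu>. 0 \<le> f x" "bdd_above (f ` space \<nu>)"
    and g: "integrable \<nu> g" "\<forall>x\<in>space \<nu>. 0 \<le> g x" "bdd_above (g ` space \<nu>)"
    and N1: "poisson_process M (intensity_measure n \<nu> f) N1"
    and Nm1: "poisson_process M (intensity_measure n \<nu> g) Nm1"
    and indep: "prob_space.indep_var M (config_space \<nu>) N1 (config_space \<nu>) Nm1"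
    and N: "N = pooled N1 Nm1"
    and \<epsilon>0: "\<epsilon>0 = sample_mark N1"
    and \<epsilon>: "monte_carlo_marks M \<nu> N \<epsilon>0 B \<epsilon>"
    and \<alpha>: "0 < \<alpha>" "\<alpha> < 1"
    and B: "B \<ge> 1"
    and K_meas: "(\<lambda>(x, x'). K x x') \<in> borel_measurable (\<nu> \<Otimes>\<^sub>M \<nu>)"
    and K_sym: "\<forall>x\<in>space \<nu>. \<forall>x'\<in>space \<nu>. K x x' = K x' x"
    and K_L2: "(\<integral>\<^sup>+(x, x'). ennreal ((K x x')\<^sup>2 * (f x + g x) * (f x' + g x')) \<partial>(\<nu> \<Otimes>\<^sub>M \<nu>)) < \<infinity>"
    and null_hyp: "\<forall>x\<in>space \<nu>. f x = g x"
  shows "{\<omega>\<in>space M. mc_test K B \<alpha> N \<epsilon>0 \<epsilon> \<omega> = 1} \<in> sets (completion M) \<and>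
    (AE \<omega> in M.
       cond_prob_given M (generated_by M \<nu> N)
         {\<omega>\<in>space M. mc_test K B \<alpha> N \<epsilon>0 \<epsilon> \<omega> = 1} \<omega>
       \<le> (of_int \<lfloor>real B * \<alpha>\<rfloor> + 1) / (real B + 1))"
proof -
  have [measurable]: "f \<in> borel_measurable \<nu>" "g \<in> borel_measurable \<nu>"
    using f g by auto
  let ?\<Lambda> = "intensity_measure n \<nu> f"
  have g\<Lambda>: "intensity_measure n \<nu> g = ?\<Lambda>"
    using null_hyp by (intro intensity_measure_cong) auto
  interpret prob_space M by (rule M)
  interpret monte_carlo_test M \<nu> ?\<Lambda> N1 Nm1 B "mark_vec B \<epsilon>" K
  proof (intro monte_carlo_test.intro marked_poisson_pair.intro poisson_pair.intro
      monte_carlo_test_axioms.intro marked_poisson_pair_axioms.intro poisson_pair_axioms.intro)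
    show "prob_space M" by (rule M)
    show "sets ?\<Lambda> = sets \<nu>" by simp
    show "finite_measure ?\<Lambda>" by (rule finite_intensity_measure[OF f(1)])
    show "non_atomic ?\<Lambda>" by (rule non_atomic_intensity_measure[OF \<nu>(2) f(1)])
    show "poisson_process M ?\<Lambda> N1" by (rule N1)
    show "poisson_process M ?\<Lambda> Nm1" using Nm1 unfolding g\<Lambda> .
    show "indep_var (config_space \<nu>) N1 (config_space \<nu>) Nm1" by (rule indep)
    show "cond_iid_marks M \<nu> (pooled N1 Nm1) (mark_vec_space B) (rademacher_vec B) (mark_vec B \<epsilon>)"
      "cond_indep_marks M \<nu> (pooled N1 Nm1) borel (sample_mark N1) (mark_vec_space B) (mark_vec B \<epsilon>)"
      using \<epsilon> unfolding monte_carlo_marks_def N \<epsilon>0 by auto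
  qed (use K_meas B in auto)
  have "{\<omega>\<in>space M. mc_test K B \<alpha> N \<epsilon>0 \<epsilon> \<omega> = 1}
      = {\<omega>\<in>space M. mc_quantile K B \<alpha> (pool \<omega>) (\<lambda>b x. mark_vec B \<epsilon> \<omega> x b) < T_stat K (pool \<omega>) (sample_mark N1 \<omega>)}"
  proof -
    have "mc_quantile K B \<alpha> (pool \<omega>) (\<lambda>b. \<epsilon> b \<omega>) = mc_quantile K B \<alpha> (pool \<omega>) (\<lambda>b x. mark_vec B \<epsilon> \<omega> x b)" for \<omega>
      by (rule mc_quantile_cong) (simp add: mark_vec_def)
    then show ?thesis by (simp add: mc_test_def N \<epsilon>0)
  qed
  then show ?thesis
    using monte_carlo_level[OF \<alpha>] by (simp only: cond_prob_given_def N simp_thms)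
qed

end
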